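(* Let $P\in\Omega^1(M;TM)$ be a product structure on the manifold $M$. Then there exists a Lie algebroid structure $(TM,q,[\![\cdot,\cdot]\!])$ on $M$, where the anchor map is $q=p^-=\frac{1}{2}(\mathrm{Id}-P)$ and the bracket is $$[\![X,Y]\!]=[X,Y]_{p^-}=\frac{1}{2}\left([X,Y]-[X,Y]_P\right)$$ for all vector fields $X,Y$ on $M$.
   Context: An almost-product structure on $M$ is a vector bundle endomorphism $P:TM\to TM$ with $P^2=\mathrm{Id}_{TM}$. It is a product structure (is integrable) if its Nijenhuis torsion vanishes, where for an endomorphism $N$ of $TM$ the Nijenhuis torsion is $T_N(X,Y)=[NX,NY]-N[NX,Y]-N[X,NY]+N^2[X,Y]$. For an endomorphism $N$ of $TM$, the contracted bracket is $[X,Y]_N=[NX,Y]+[X,NY]-N[X,Y]$. A Lie algebroid on $M$ is a triple $(E,q,[\![\cdot,\cdot]\!])$: a vector bundle $E\to M$, a vector bundle map $q:E\to TM$ over the identity (the anchor), and a Lie bracket $[\![\cdot,\cdot]\!]$ on $\Gamma(E)$ satisfying $[\![A,fB]\!]=f[\![A,B]\!]+(qA)(f)\,B$ for all $A,B\in\Gamma(E)$, $f\in C^\infty(M)$. *)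

theory Defs
  imports "HOL-Analysis.Analysis"
begin

section \<open>Smooth maps between Euclidean spaces\<close>

text \<open>Iterated directional derivatives: on an open subset of a finite-dimensional space this is
  the usual notion of a \<open>k\<close> times continuously differentiable map.\<close>

primrec Ck_on :: "nat \<Rightarrow> 'b::euclidean_space set \<Rightarrow> ('b \<Rightarrow> 'c::real_normed_vector) \<Rightarrow> bool" where
  "Ck_on 0 S f \<longleftrightarrow> continuous_on S f"
| "Ck_on (Suc k) S f \<longleftrightarrow> (\<forall>x\<in>S. f differentiable (at x)) \<and>
     (\<forall>v. Ck_on k S (\<lambda>x. frechet_derivative f (at x) v))"

definition smooth_on :: "'b::euclidean_space set \<Rightarrow> ('b \<Rightarrow> 'c::real_normed_vector) \<Rightarrow> bool" where
  "smooth_on S f \<longleftrightarrow> (\<forall>k. Ck_on k S f)"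


section \<open>Smooth manifolds\<close>

text \<open>The underlying set of the manifold \<open>M\<close> is the whole type \<open>'a\<close>, whose topology is Hausdorff
  and second countable by its type class; \<open>'b\<close> is the model space, so that
  \<open>dim M = DIM('b)\<close>. A chart is a pair \<open>(U, \<phi>)\<close>; the values of \<open>\<phi>\<close> outside \<open>U\<close> are irrelevant.
  The smooth structure is the one generated by the atlas \<open>\<A>\<close>, which need not be maximal.\<close>

type_synonym ('a, 'b) atlas = "('a set \<times> ('a \<Rightarrow> 'b)) set"

definition smooth_atlas ::
  "('a::{t2_space,second_countable_topology}, 'b::euclidean_space) atlas \<Rightarrow> bool" where
  "smooth_atlas \<A> \<longleftrightarrow>
     (\<Union>(U, \<phi>)\<in>\<A>. U) = UNIV \<and>
     (\<forall>(U, \<phi>)\<in>\<A>. open U \<and> open (\<phi> ` U) \<and> homeomorphism U (\<phi> ` U) \<phi> (inv_into U \<phi>)) \<and>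
     (\<forall>(U, \<phi>)\<in>\<A>. \<forall>(V, \<psi>)\<in>\<A>. smooth_on (\<phi> ` (U \<inter> V)) (\<psi> \<circ> inv_into U \<phi>))"

text \<open>Smoothness of \<open>f\<close> on an open subset \<open>W\<close> of \<open>M\<close>.\<close>

definition msmooth_on ::
  "('a::{t2_space,second_countable_topology}, 'b::euclidean_space) atlas \<Rightarrow> 'a set \<Rightarrow>
     ('a \<Rightarrow> 'c::real_normed_vector) \<Rightarrow> bool" where
  "msmooth_on \<A> W f \<longleftrightarrow> (\<forall>(U, \<phi>)\<in>\<A>. smooth_on (\<phi> ` (U \<inter> W)) (f \<circ> inv_into U \<phi>))"

definition smooth_near ::
  "('a::{t2_space,second_countable_topology}, 'b::euclidean_space) atlas \<Rightarrow> 'a \<Rightarrow>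
     ('a \<Rightarrow> real) \<Rightarrow> bool" where
  "smooth_near \<A> p f \<longleftrightarrow> (\<exists>W. open W \<and> p \<in> W \<and> msmooth_on \<A> W f)"

definition smooth_functions ::
  "('a::{t2_space,second_countable_topology}, 'b::euclidean_space) atlas \<Rightarrow> ('a \<Rightarrow> real) set" where
  "smooth_functions \<A> = {f. msmooth_on \<A> UNIV f}"


section \<open>Vector bundles\<close>

text \<open>A vector bundle over \<open>M\<close> is given by its fibres with their vector space operations, and by
  its local trivialisations: a pair \<open>(U, \<tau>)\<close> consists of an open set \<open>U\<close> and isomorphisms
  \<open>\<tau> p\<close> from the fibre at \<open>p \<in> U\<close> to the typical fibre \<open>'k\<close>, such that any two of them differ by
  a smooth family of linear automorphisms of \<open>'k\<close>. The total space is the disjoint union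
  of the fibres; its smooth structure is the one that makes the trivialisations diffeomorphisms.
  The vector space axioms for the fibres follow by transport along \<open>\<tau> p\<close>.\<close>

record ('a, 'e, 'k) vbundle =
  fibre :: "'a \<Rightarrow> 'e set"
  vzero :: "'a \<Rightarrow> 'e"
  vadd :: "'a \<Rightarrow> 'e \<Rightarrow> 'e \<Rightarrow> 'e"
  vscale :: "'a \<Rightarrow> real \<Rightarrow> 'e \<Rightarrow> 'e"
  trivs :: "('a set \<times> ('a \<Rightarrow> 'e \<Rightarrow> 'k)) set"

definition vector_bundle ::
  "('a::{t2_space,second_countable_topology}, 'b::euclidean_space) atlas \<Rightarrow>
     ('a, 'e, 'k::euclidean_space) vbundle \<Rightarrow> bool" where
  "vector_bundle \<A> E \<longleftrightarrow>
     (\<forall>p. vzero E p \<in> fibre E p) \<and>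
     (\<forall>p. \<forall>v\<in>fibre E p. \<forall>w\<in>fibre E p. vadd E p v w \<in> fibre E p) \<and>
     (\<forall>p c. \<forall>v\<in>fibre E p. vscale E p c v \<in> fibre E p) \<and>
     (\<Union>(U, \<tau>)\<in>trivs E. U) = UNIV \<and>
     (\<forall>(U, \<tau>)\<in>trivs E. open U \<and>
        (\<forall>p\<in>U. bij_betw (\<tau> p) (fibre E p) UNIV \<and>
           \<tau> p (vzero E p) = 0 \<and>
           (\<forall>v\<in>fibre E p. \<forall>w\<in>fibre E p. \<tau> p (vadd E p v w) = \<tau> p v + \<tau> p w) \<and>
           (\<forall>c. \<forall>v\<in>fibre E p. \<tau> p (vscale E p c v) = c *\<^sub>R \<tau> p v))) \<and>
     (\<forall>(U, \<tau>)\<in>trivs E. \<forall>(V, \<sigma>)\<in>trivs E. \<forall>w.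
        msmooth_on \<A> (U \<inter> V) (\<lambda>p. \<sigma> p (inv_into (fibre E p) (\<tau> p) w)))"

text \<open>The space \<open>\<Gamma>(E)\<close> of smooth sections and its operations.\<close>

definition sections ::
  "('a::{t2_space,second_countable_topology}, 'b::euclidean_space) atlas \<Rightarrow>
     ('a, 'e, 'k::euclidean_space) vbundle \<Rightarrow> ('a \<Rightarrow> 'e) set" where
  "sections \<A> E = {s. (\<forall>p. s p \<in> fibre E p) \<and>
     (\<forall>(U, \<tau>)\<in>trivs E. msmooth_on \<A> U (\<lambda>p. \<tau> p (s p)))}"

definition sec_zero :: "('a, 'e, 'k) vbundle \<Rightarrow> 'a \<Rightarrow> 'e" where
  "sec_zero E = (\<lambda>p. vzero E p)"

definition sec_add :: "('a, 'e, 'k) vbundle \<Rightarrow> ('a \<Rightarrow> 'e) \<Rightarrow> ('a \<Rightarrow> 'e) \<Rightarrow> 'a \<Rightarrow> 'e" where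
  "sec_add E s t = (\<lambda>p. vadd E p (s p) (t p))"

definition sec_mult :: "('a, 'e, 'k) vbundle \<Rightarrow> ('a \<Rightarrow> real) \<Rightarrow> ('a \<Rightarrow> 'e) \<Rightarrow> 'a \<Rightarrow> 'e" where
  "sec_mult E f s = (\<lambda>p. vscale E p (f p) (s p))"

text \<open>Vector bundle maps over the identity of \<open>M\<close>. By fibrewise linearity, smoothness as a map
  between total spaces amounts to smoothness of the matrix entries in local trivialisations.\<close>

definition vbundle_map ::
  "('a::{t2_space,second_countable_topology}, 'b::euclidean_space) atlas \<Rightarrow>
     ('a, 'e, 'k::euclidean_space) vbundle \<Rightarrow> ('a, 'f, 'l::euclidean_space) vbundle \<Rightarrow>
     ('a \<Rightarrow> 'e \<Rightarrow> 'f) \<Rightarrow> bool" where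
  "vbundle_map \<A> E F Q \<longleftrightarrow>
     (\<forall>p. \<forall>v\<in>fibre E p. Q p v \<in> fibre F p) \<and>
     (\<forall>p. \<forall>v\<in>fibre E p. \<forall>w\<in>fibre E p. Q p (vadd E p v w) = vadd F p (Q p v) (Q p w)) \<and>
     (\<forall>p c. \<forall>v\<in>fibre E p. Q p (vscale E p c v) = vscale F p c (Q p v)) \<and>
     (\<forall>(U, \<tau>)\<in>trivs E. \<forall>(V, \<sigma>)\<in>trivs F. \<forall>w.
        msmooth_on \<A> (U \<inter> V) (\<lambda>p. \<sigma> p (Q p (inv_into (fibre E p) (\<tau> p) w))))"

definition on_sections :: "('a \<Rightarrow> 'e \<Rightarrow> 'f) \<Rightarrow> ('a \<Rightarrow> 'e) \<Rightarrow> 'a \<Rightarrow> 'f" where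
  "on_sections Q s = (\<lambda>p. Q p (s p))"


section \<open>The tangent bundle\<close>

text \<open>Tangent vectors at \<open>p\<close> are derivations on functions that are smooth near \<open>p\<close>. Such a
  derivation only depends on germs, since the functions are arbitrary away from \<open>p\<close>. The value
  on all other functions is fixed to be \<open>0\<close>, so that equality of tangent vectors is equality in
  HOL.\<close>

type_synonym 'a tvec = "('a \<Rightarrow> real) \<Rightarrow> real"

definition tangent_space ::
  "('a::{t2_space,second_countable_topology}, 'b::euclidean_space) atlas \<Rightarrow> 'a \<Rightarrow> 'a tvec set" where
  "tangent_space \<A> p = {v.
     (\<forall>f g. smooth_near \<A> p f \<longrightarrow> smooth_near \<A> p g \<longrightarrow>
        v (\<lambda>x. f x + g x) = v f + v g \<and>
        v (\<lambda>x. f x * g x) = v f * g p + f p * v g) \<and>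
     (\<forall>f c. smooth_near \<A> p f \<longrightarrow> v (\<lambda>x. c * f x) = c * v f) \<and>
     (\<forall>f. \<not> smooth_near \<A> p f \<longrightarrow> v f = 0)}"

text \<open>A chart \<open>(U, \<phi>)\<close> trivialises \<open>TM\<close> over \<open>U\<close> by sending \<open>v\<close> to the vector with components
  \<open>v(\<phi>\<^sub>b)\<close>, where \<open>\<phi>\<^sub>b\<close> are the coordinate functions of \<open>\<phi>\<close>.\<close>

definition tangent_bundle ::
  "('a::{t2_space,second_countable_topology}, 'b::euclidean_space) atlas \<Rightarrow>
     ('a, 'a tvec, 'b) vbundle" where
  "tangent_bundle \<A> = \<lparr>
     fibre = tangent_space \<A>,
     vzero = (\<lambda>p f. 0),
     vadd = (\<lambda>p v w f. v f + w f),
     vscale = (\<lambda>p c v f. c * v f),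
     trivs = {(U, \<lambda>p v. \<Sum>b\<in>Basis. v (\<lambda>x. \<phi> x \<bullet> b) *\<^sub>R b) | U \<phi>. (U, \<phi>) \<in> \<A>}\<rparr>"

definition vector_fields ::
  "('a::{t2_space,second_countable_topology}, 'b::euclidean_space) atlas \<Rightarrow> ('a \<Rightarrow> 'a tvec) set" where
  "vector_fields \<A> = sections \<A> (tangent_bundle \<A>)"

definition apply_field :: "('a \<Rightarrow> 'a tvec) \<Rightarrow> ('a \<Rightarrow> real) \<Rightarrow> 'a \<Rightarrow> real" where
  "apply_field X f = (\<lambda>p. X p f)"

definition Lie_bracket ::
  "('a::{t2_space,second_countable_topology}, 'b::euclidean_space) atlas \<Rightarrow>
     ('a \<Rightarrow> 'a tvec) \<Rightarrow> ('a \<Rightarrow> 'a tvec) \<Rightarrow> 'a \<Rightarrow> 'a tvec" where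
  "Lie_bracket \<A> X Y = (\<lambda>p f. if smooth_near \<A> p f
     then X p (apply_field Y f) - Y p (apply_field X f) else 0)"


section \<open>Product structures\<close>

definition contracted_bracket ::
  "('a::{t2_space,second_countable_topology}, 'b::euclidean_space) atlas \<Rightarrow>
     ('a \<Rightarrow> 'a tvec \<Rightarrow> 'a tvec) \<Rightarrow>
     ('a \<Rightarrow> 'a tvec) \<Rightarrow> ('a \<Rightarrow> 'a tvec) \<Rightarrow> 'a \<Rightarrow> 'a tvec" where
  "contracted_bracket \<A> N X Y = (\<lambda>p f.
     Lie_bracket \<A> (on_sections N X) Y p f + Lie_bracket \<A> X (on_sections N Y) p f
     - on_sections N (Lie_bracket \<A> X Y) p f)"

definition Nijenhuis_torsion ::
  "('a::{t2_space,second_countable_topology}, 'b::euclidean_space) atlas \<Rightarrow>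
     ('a \<Rightarrow> 'a tvec \<Rightarrow> 'a tvec) \<Rightarrow>
     ('a \<Rightarrow> 'a tvec) \<Rightarrow> ('a \<Rightarrow> 'a tvec) \<Rightarrow> 'a \<Rightarrow> 'a tvec" where
  "Nijenhuis_torsion \<A> N X Y = (\<lambda>p f.
     Lie_bracket \<A> (on_sections N X) (on_sections N Y) p f
     - on_sections N (Lie_bracket \<A> (on_sections N X) Y) p f
     - on_sections N (Lie_bracket \<A> X (on_sections N Y)) p f
     + on_sections N (on_sections N (Lie_bracket \<A> X Y)) p f)"

definition almost_product_structure ::
  "('a::{t2_space,second_countable_topology}, 'b::euclidean_space) atlas \<Rightarrow>
     ('a \<Rightarrow> 'a tvec \<Rightarrow> 'a tvec) \<Rightarrow> bool" where
  "almost_product_structure \<A> P \<longleftrightarrow>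
     vbundle_map \<A> (tangent_bundle \<A>) (tangent_bundle \<A>) P \<and>
     (\<forall>p. \<forall>v\<in>tangent_space \<A> p. P p (P p v) = v)"

definition product_structure ::
  "('a::{t2_space,second_countable_topology}, 'b::euclidean_space) atlas \<Rightarrow>
     ('a \<Rightarrow> 'a tvec \<Rightarrow> 'a tvec) \<Rightarrow> bool" where
  "product_structure \<A> P \<longleftrightarrow> almost_product_structure \<A> P \<and>
     (\<forall>X\<in>vector_fields \<A>. \<forall>Y\<in>vector_fields \<A>.
        Nijenhuis_torsion \<A> P X Y = sec_zero (tangent_bundle \<A>))"

definition p_minus :: "('a \<Rightarrow> 'a tvec \<Rightarrow> 'a tvec) \<Rightarrow> 'a \<Rightarrow> 'a tvec \<Rightarrow> 'a tvec" where
  "p_minus P = (\<lambda>p v f. 1/2 * (v f - P p v f))"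


section \<open>Lie algebroids\<close>

text \<open>A real Lie bracket on the vector space \<open>\<Gamma>(E)\<close>.\<close>

definition lie_bracket_on_sections ::
  "('a::{t2_space,second_countable_topology}, 'b::euclidean_space) atlas \<Rightarrow>
     ('a, 'e, 'k::euclidean_space) vbundle \<Rightarrow>
     (('a \<Rightarrow> 'e) \<Rightarrow> ('a \<Rightarrow> 'e) \<Rightarrow> 'a \<Rightarrow> 'e) \<Rightarrow> bool" where
  "lie_bracket_on_sections \<A> E br \<longleftrightarrow>
     (\<forall>A\<in>sections \<A> E. \<forall>B\<in>sections \<A> E. br A B \<in> sections \<A> E) \<and>
     (\<forall>A\<in>sections \<A> E. \<forall>B\<in>sections \<A> E. \<forall>C\<in>sections \<A> E.
        br (sec_add E A B) C = sec_add E (br A C) (br B C) \<and>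
        br A (sec_add E B C) = sec_add E (br A B) (br A C)) \<and>
     (\<forall>c. \<forall>A\<in>sections \<A> E. \<forall>B\<in>sections \<A> E.
        br (sec_mult E (\<lambda>_. c) A) B = sec_mult E (\<lambda>_. c) (br A B) \<and>
        br A (sec_mult E (\<lambda>_. c) B) = sec_mult E (\<lambda>_. c) (br A B)) \<and>
     (\<forall>A\<in>sections \<A> E. br A A = sec_zero E) \<and>
     (\<forall>A\<in>sections \<A> E. \<forall>B\<in>sections \<A> E. \<forall>C\<in>sections \<A> E.
        sec_add E (br A (br B C)) (sec_add E (br B (br C A)) (br C (br A B))) = sec_zero E)"

definition lie_algebroid ::
  "('a::{t2_space,second_countable_topology}, 'b::euclidean_space) atlas \<Rightarrow>
     ('a, 'e, 'k::euclidean_space) vbundle \<Rightarrow> ('a \<Rightarrow> 'e \<Rightarrow> 'a tvec) \<Rightarrow>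
     (('a \<Rightarrow> 'e) \<Rightarrow> ('a \<Rightarrow> 'e) \<Rightarrow> 'a \<Rightarrow> 'e) \<Rightarrow> bool" where
  "lie_algebroid \<A> E q br \<longleftrightarrow>
     vector_bundle \<A> E \<and>
     vbundle_map \<A> E (tangent_bundle \<A>) q \<and>
     lie_bracket_on_sections \<A> E br \<and>
     (\<forall>A\<in>sections \<A> E. \<forall>B\<in>sections \<A> E. \<forall>f\<in>smooth_functions \<A>.
        br A (sec_mult E f B) =
          sec_add E (sec_mult E f (br A B))
            (sec_mult E (apply_field (on_sections q A) f) B))"

end

theory Submission
  imports Defs "HOL-Library.Function_Algebras"
begin

text \<open>Write \<open>N = p\<^sup>-\<close>. Since \<open>P\<^sup>2 = Id\<close>, the torsion of \<open>N\<close> is a quarter of that of \<open>P\<close>, so it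
  vanishes, that is \<open>[NX, NY] = N [X, Y]\<^sub>N\<close>. Substituting this into the double contracted bracket
  turns its cyclic sum into a combination of Jacobi sums of the ordinary bracket, with
  \<open>N\<close> applied to some of the arguments or to the whole sum. The Leibniz rule holds for the
  contracted bracket of any endomorphism. That the tangent bundle is a vector bundle rests on
  Hadamard's lemma: a derivation at a point is determined by its values on the coordinates.\<close>

section \<open>Calculus of smooth maps\<close>

text \<open>The quarter is the square of the 1/2 in \<open>p_minus\<close>: the torsion is quadratic
  in the endomorphism and does not change when a constant multiple of the identity is added to it.
  Torsion and Jacobi sums involve the bracket only through bilinearity, antisymmetry and the Jacobi
  identity, so these computations live in an abstract real Lie algebra with a linear map. The
  manifold enters through closure of the vector fields under bracket and endomorphism, and through
  the Leibniz rule. Since tangent vectors are derivations, the bracket is a plain commutator and its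
  Jacobi identity is a cancellation; the price is that the tangent spaces must be shown to have the
  right dimension. The factors in Hadamard's lemma have to be smooth themselves, because a
  derivation obeys the product rule only on functions smooth near the point. This dictates the
  integral form of the remainder and differentiation under the integral sign to every order. A
  second recurring concern is that functions are total but smooth only near a point, so identities
  between them hold only on a neighbourhood and must be localised before a tangent vector is
  applied.\<close>

text \<open>Openness matters because the derivative at a point sees a full neighbourhood. On an open
  set equal functions have equal derivatives, so the induction passes to directional
  derivatives.\<close>

lemma Ck_on_cong:
  assumes "open S" "\<And>x. x \<in> S \<Longrightarrow> f x = g x" "Ck_on k S f"
  shows "Ck_on k S g"
  using assms(2,3)
proof (induction k arbitrary: f g)
  case 0
  then show ?case by (simp cong: continuous_on_cong)
next
  case (Suc k)
  have "g differentiable (at x)" if "x \<in> S" for x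
  proof -
    obtain D where "(f has_derivative D) (at x)"
      using Suc.prems(2) \<open>x \<in> S\<close> by (auto simp: differentiable_def)
    from has_derivative_transform_within_open[OF this assms(1) \<open>x \<in> S\<close> Suc.prems(1)]
    show ?thesis by (auto simp: differentiable_def)
  qed
  moreover have fd: "frechet_derivative f (at x) = frechet_derivative g (at x)" if "x \<in> S" for x
    using Suc.prems that \<open>open S\<close> by (intro frechet_derivative_transform_within_open) auto
  have "Ck_on k S (\<lambda>x. frechet_derivative g (at x) v)" for v
    by (rule Suc.IH[of "\<lambda>x. frechet_derivative f (at x) v"]) (use fd Suc.prems(2) in auto)
  ultimately show ?case by simp
qed

text \<open>\<open>frechet_derivative\<close> is a choice term; uniqueness of derivatives lets any
  explicit formula \<open>f'\<close> stand in for it. The closure rules below therefore only have to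
  exhibit a derivative and its regularity.\<close>

lemma Ck_on_SucI:
  assumes "open S" "\<And>x. x \<in> S \<Longrightarrow> (f has_derivative f' x) (at x)" "\<And>v. Ck_on k S (\<lambda>x. f' x v)"
  shows "Ck_on (Suc k) S f"
proof -
  have "Ck_on k S (\<lambda>x. frechet_derivative f (at x) v)" for v
    using assms(2) frechet_derivative_at
    by (intro Ck_on_cong[OF assms(1) _ assms(3)[of v]]) fastforce
  then show ?thesis using assms(2) by (auto simp: differentiable_def)
qed

lemma Ck_on_Suc_derivative:
  "Ck_on (Suc k) S f \<Longrightarrow> x \<in> S \<Longrightarrow> (f has_derivative frechet_derivative f (at x)) (at x)"
  by (simp add: frechet_derivative_works)

lemma Ck_on_SucD: "Ck_on (Suc k) S f \<Longrightarrow> Ck_on k S f"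
proof (induction k arbitrary: f)
  case 0
  then show ?case
    by (simp add: continuous_at_imp_continuous_on differentiable_imp_continuous_within)
qed auto

lemma Ck_on_continuous: "Ck_on k S f \<Longrightarrow> continuous_on S f"
  by (induction k) (use Ck_on_SucD in force)+

lemma Ck_on_subset: "Ck_on k S f \<Longrightarrow> T \<subseteq> S \<Longrightarrow> Ck_on k T f"
  by (induction k arbitrary: f) (auto intro: continuous_on_subset)

lemma Ck_on_const: "Ck_on k S (\<lambda>_. c)"
  by (induction k arbitrary: c) auto

lemma Ck_on_add:
  assumes "open S" "Ck_on k S f" "Ck_on k S g"
  shows "Ck_on k S (\<lambda>x. f x + g x)"
  using assms(2,3)
proof (induction k arbitrary: f g)
  case 0
  then show ?case by (simp add: continuous_on_add)
next
  case (Suc k)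
  show ?case
    by (rule Ck_on_SucI[OF assms(1) has_derivative_add])
      (use Suc in \<open>auto simp: frechet_derivative_works\<close>)
qed

lemma Ck_on_linear:
  assumes "open S" "bounded_linear L" "Ck_on k S f"
  shows "Ck_on k S (\<lambda>x. L (f x))"
  using assms(3)
proof (induction k arbitrary: f)
  case 0
  then show ?case by (simp add: bounded_linear.continuous_on[OF assms(2)])
next
  case (Suc k)
  show ?case
    by (rule Ck_on_SucI[OF assms(1) bounded_linear.has_derivative[OF assms(2)]])
      (use Suc in \<open>auto simp: frechet_derivative_works\<close>)
qed

lemma Ck_on_scaleR:
  assumes "open S" "Ck_on k S f" "Ck_on k S g"
  shows "Ck_on k S (\<lambda>x. f x *\<^sub>R g x)"
  using assms(2,3)
proof (induction k arbitrary: f g)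
  case 0
  then show ?case by (simp add: continuous_on_scaleR)
next
  case (Suc k)
  show ?case
  proof (rule Ck_on_SucI[OF assms(1) has_derivative_scaleR])
    show "(f has_derivative frechet_derivative f (at x)) (at x)"
         "(g has_derivative frechet_derivative g (at x)) (at x)" if "x \<in> S" for x
      using Suc.prems that by (auto simp: frechet_derivative_works)
    \<comment> \<open>The product rule keeps \<open>f\<close> and \<open>g\<close> undifferentiated,
      so they are needed at order \<open>k\<close> as well, which \<open>Ck_on_SucD\<close>
      provides.\<close>
    show "Ck_on k S (\<lambda>x. f x *\<^sub>R frechet_derivative g (at x) v
        + frechet_derivative f (at x) v *\<^sub>R g x)" for v
      using Suc.prems Suc.prems[THEN Ck_on_SucD] by (intro Ck_on_add[OF assms(1)] Suc.IH) simp_all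
  qed
qed

lemma Ck_on_sum:
  assumes "open S" "\<And>i. i \<in> I \<Longrightarrow> Ck_on k S (f i)"
  shows "Ck_on k S (\<lambda>x. \<Sum>i\<in>I. f i x)"
  using assms(2)
  by (induction I rule: infinite_finite_induct) (auto intro: Ck_on_add assms(1) simp: Ck_on_const)

lemma linear_Basis_expansion:
  fixes L :: "'b::euclidean_space \<Rightarrow> 'c::real_normed_vector"
  assumes "linear L"
  shows "L v = (\<Sum>b\<in>Basis. (v \<bullet> b) *\<^sub>R L b)"
proof -
  have "L v = L (\<Sum>b\<in>Basis. (v \<bullet> b) *\<^sub>R b)" by (simp add: euclidean_representation)
  also have "\<dots> = (\<Sum>b\<in>Basis. (v \<bullet> b) *\<^sub>R L b)"
    by (simp add: linear_sum[OF assms] linear_scale[OF assms])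
  finally show ?thesis .
qed

lemma Ck_on_compose:
  fixes g :: "'b::euclidean_space \<Rightarrow> 'd::euclidean_space"
  assumes "open S" "open T" "g ` S \<subseteq> T" "Ck_on k T f" "Ck_on k S g"
  shows "Ck_on k S (\<lambda>x. f (g x))"
  using assms(4,5)
proof (induction k arbitrary: f)
  case 0
  then show ?case using assms(3) by (auto intro: continuous_on_compose2)
next
  case (Suc k)
  let ?f' = "\<lambda>y. frechet_derivative f (at y)" and ?g' = "\<lambda>x. frechet_derivative g (at x)"
  show ?case
  proof (rule Ck_on_SucI[OF assms(1)])
    fix x assume x: "x \<in> S"
    then have f: "(f has_derivative ?f' (g x)) (at (g x))"
      using Suc.prems assms(3) by (intro Ck_on_Suc_derivative) auto
    have "((\<lambda>x. f (g x)) has_derivative (\<lambda>v. ?f' (g x) (?g' x v))) (at x)"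
      using has_derivative_compose[OF Ck_on_Suc_derivative[OF Suc.prems(2) x] f] .
    \<comment> \<open>\<open>Ck_on\<close> controls derivatives of \<open>f\<close> in fixed
      directions only, while the chain rule produces a direction that varies with \<open>x\<close>.
      Expanding over the basis moves the variation into scalar coefficients.\<close>
    also have "(\<lambda>v. ?f' (g x) (?g' x v)) = (\<lambda>v. \<Sum>b\<in>Basis. (?g' x v \<bullet> b) *\<^sub>R ?f' (g x) b)"
      using linear_Basis_expansion[OF has_derivative_linear[OF f]] by blast
    finally show "((\<lambda>x. f (g x)) has_derivative
        (\<lambda>v. \<Sum>b\<in>Basis. (?g' x v \<bullet> b) *\<^sub>R ?f' (g x) b)) (at x)" .
  next
    fix v
    have "Ck_on k S g" using Suc.prems Ck_on_SucD by blast
    then show "Ck_on k S (\<lambda>x. \<Sum>b\<in>Basis. (?g' x v \<bullet> b) *\<^sub>R ?f' (g x) b)"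
      using Suc.prems
      by (intro Ck_on_sum Ck_on_scaleR assms(1) Suc.IH[of "\<lambda>y. ?f' y _"]
          Ck_on_linear[OF _ bounded_linear_inner_left]) auto
  qed
qed

lemma smooth_on_derivative:
  "smooth_on S f \<Longrightarrow> x \<in> S \<Longrightarrow> (f has_derivative frechet_derivative f (at x)) (at x)"
  unfolding smooth_on_def using Ck_on_Suc_derivative by blast

lemma smooth_on_frechet_derivative:
  "smooth_on S f \<Longrightarrow> smooth_on S (\<lambda>x. frechet_derivative f (at x) v)"
  unfolding smooth_on_def using Ck_on.simps(2) by blast

lemma smooth_on_cong:
  "open S \<Longrightarrow> (\<And>x. x \<in> S \<Longrightarrow> f x = g x) \<Longrightarrow> smooth_on S f \<Longrightarrow> smooth_on S g"
  unfolding smooth_on_def using Ck_on_cong by blast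

lemma smooth_on_subset: "smooth_on S f \<Longrightarrow> T \<subseteq> S \<Longrightarrow> smooth_on T f"
  unfolding smooth_on_def using Ck_on_subset by blast

lemma smooth_on_const: "smooth_on S (\<lambda>_. c)"
  by (simp add: smooth_on_def Ck_on_const)

lemma smooth_on_add:
  "open S \<Longrightarrow> smooth_on S f \<Longrightarrow> smooth_on S g \<Longrightarrow> smooth_on S (\<lambda>x. f x + g x)"
  by (simp add: smooth_on_def Ck_on_add)

lemma smooth_on_linear:
  "open S \<Longrightarrow> bounded_linear L \<Longrightarrow> smooth_on S f \<Longrightarrow> smooth_on S (\<lambda>x. L (f x))"
  by (simp add: smooth_on_def Ck_on_linear)

lemma smooth_on_scaleR:
  "open S \<Longrightarrow> smooth_on S f \<Longrightarrow> smooth_on S g \<Longrightarrow> smooth_on S (\<lambda>x. f x *\<^sub>R g x)"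
  by (simp add: smooth_on_def Ck_on_scaleR)

lemma smooth_on_sum:
  "open S \<Longrightarrow> (\<And>i. i \<in> I \<Longrightarrow> smooth_on S (f i)) \<Longrightarrow> smooth_on S (\<lambda>x. \<Sum>i\<in>I. f i x)"
  by (simp add: smooth_on_def Ck_on_sum)

lemma smooth_on_compose:
  fixes g :: "'b::euclidean_space \<Rightarrow> 'd::euclidean_space"
  shows "open S \<Longrightarrow> open T \<Longrightarrow> g ` S \<subseteq> T \<Longrightarrow> smooth_on T f \<Longrightarrow> smooth_on S g \<Longrightarrow>
    smooth_on S (\<lambda>x. f (g x))"
  by (simp add: smooth_on_def Ck_on_compose)

section \<open>Hadamard's lemma\<close>

lemma segment_in_ball:
  fixes a x :: "'b::real_normed_vector"
  assumes "x \<in> ball a r" "t \<in> {0..1}"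
  shows "a + t *\<^sub>R (x - a) \<in> ball a r"
proof -
  have "norm (t *\<^sub>R (x - a)) \<le> norm (x - a)"
    using assms(2) by (simp add: mult_left_le_one_le)
  then show ?thesis using assms(1) by (simp add: dist_norm norm_minus_commute)
qed

lemma continuous_on_segment_integrand:
  fixes h :: "'b::euclidean_space \<Rightarrow> 'c::banach"
  assumes "continuous_on (ball a r) h"
  shows "continuous_on (ball a r \<times> {0..1}) (\<lambda>(x, t). t ^ m *\<^sub>R h (a + t *\<^sub>R (x - a)))"
  unfolding case_prod_beta
  by (intro continuous_intros continuous_on_compose2[OF assms]) (auto intro: segment_in_ball)

text \<open>Differentiating \<open>h (a + t *\<^sub>R (x - a))\<close> in \<open>x\<close> brings
  out a factor \<open>t\<close>, so the unweighted integral is not preserved by differentiation. The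
  weight \<open>t ^ m\<close> is the generalisation that makes the induction go through, each
  derivative raising \<open>m\<close> by one.\<close>

lemma Ck_on_segment_integral:
  fixes h :: "'b::euclidean_space \<Rightarrow> 'c::banach"
  assumes "Ck_on k (ball a r) h"
  shows "Ck_on k (ball a r) (\<lambda>x. integral {0..1::real} (\<lambda>t. t ^ m *\<^sub>R h (a + t *\<^sub>R (x - a))))"
  using assms
proof (induction k arbitrary: h m)
  case 0
  then show ?case
    using integral_continuous_on_param[of "ball a r" 0 1 "\<lambda>x t. t ^ m *\<^sub>R h (a + t *\<^sub>R (x - a))"]
      continuous_on_segment_integrand[of a r h m]
    unfolding cbox_interval Ck_on.simps by blast
next
  case (Suc k)
  let ?B = "ball a r" and ?h' = "\<lambda>y. frechet_derivative h (at y)"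
  \<comment> \<open>The Leibniz integral rule asks for the derivative as a bounded linear map
    depending continuously on the parameters. \<open>Blinfun\<close> is meaningful only where its
    argument is bounded and linear, which is known for \<open>x\<close> in the ball and
    \<open>t\<close> in the unit interval.\<close>
  define D where "D x t = Blinfun (\<lambda>v. t ^ Suc m *\<^sub>R ?h' (a + t *\<^sub>R (x - a)) v)" for x and t :: real
  have h': "(h has_derivative ?h' y) (at y)" if "y \<in> ?B" for y
    using Suc.prems that by (rule Ck_on_Suc_derivative)
  have D: "blinfun_apply (D x t) = (\<lambda>v. t ^ Suc m *\<^sub>R ?h' (a + t *\<^sub>R (x - a)) v)"
    if "x \<in> ?B" "t \<in> {0..1}" for x t
    unfolding D_def using h'[OF segment_in_ball[OF that]]
    by (intro bounded_linear_Blinfun_apply)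
      (blast intro: bounded_linear_const_scaleR has_derivative_bounded_linear)
  have der: "((\<lambda>x. t ^ m *\<^sub>R h (a + t *\<^sub>R (x - a))) has_derivative blinfun_apply (D x t)) (at x within ?B)"
    if "x \<in> ?B" "t \<in> cbox 0 1" for x t
  proof -
    have t: "t \<in> {0..1}" using that(2) by simp
    have "((\<lambda>x. a + t *\<^sub>R (x - a)) has_derivative (\<lambda>v. t *\<^sub>R v)) (at x within ?B)"
      by (auto intro!: derivative_eq_intros)
    from has_derivative_compose[OF this h'[OF segment_in_ball[OF that(1) t]]]
    have "((\<lambda>x. t ^ m *\<^sub>R h (a + t *\<^sub>R (x - a))) has_derivative
        (\<lambda>v. t ^ m *\<^sub>R ?h' (a + t *\<^sub>R (x - a)) (t *\<^sub>R v))) (at x within ?B)"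
      by (rule has_derivative_scaleR_right)
    moreover have "?h' (a + t *\<^sub>R (x - a)) (t *\<^sub>R v) = t *\<^sub>R ?h' (a + t *\<^sub>R (x - a)) v" for v
      using h'[OF segment_in_ball[OF that(1) t]] has_derivative_linear linear_scale by blast
    ultimately show ?thesis by (simp add: D[OF that(1) t] mult.commute)
  qed
  have "continuous_on ?B h" using Suc.prems Ck_on_continuous by blast
  note cont_int = continuous_on_segment_integrand[OF this, of m]
  have Pair: "continuous_on {0..1::real} (\<lambda>t. (x, t))" for x :: 'b
    by (intro continuous_intros)
  have int: "(\<lambda>t. t ^ m *\<^sub>R h (a + t *\<^sub>R (x - a))) integrable_on cbox 0 (1::real)" if "x \<in> ?B" for x
  proof -
    have "continuous_on {0..1::real} (\<lambda>t. t ^ m *\<^sub>R h (a + t *\<^sub>R (x - a)))"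
      using continuous_on_compose2[OF cont_int Pair] that by (simp add: image_subset_iff)
    then show ?thesis by (intro integrable_continuous) simp
  qed
  have contD: "continuous_on (?B \<times> cbox 0 1) (\<lambda>(x, t). D x t)"
    unfolding case_prod_beta
  \<comment> \<open>In finite dimension, continuity in the operator norm follows from continuity on
    each basis vector, and that is what \<open>Ck_on\<close> supplies.\<close>
  proof (rule continuous_on_blinfun_componentwise)
    fix i :: 'b
    have "Ck_on k ?B (\<lambda>y. ?h' y i)" using Suc.prems by simp
    from continuous_on_segment_integrand[OF Ck_on_continuous[OF this], of "Suc m"]
    show "continuous_on (?B \<times> cbox 0 1) (\<lambda>z. blinfun_apply (D (fst z) (snd z)) i)"
      unfolding case_prod_beta cbox_interval
      by (rule continuous_on_eq) (use D in \<open>auto simp: mem_Times_iff\<close>)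
  qed
  have intD: "D x integrable_on {0..1}" if "x \<in> ?B" for x
  proof -
    have "continuous_on {0..1::real} (D x)"
      using continuous_on_compose2[OF contD Pair] that by (simp add: image_subset_iff)
    then show ?thesis using integrable_continuous[of 0 1 "D x"] by simp
  qed
  show ?case
  proof (rule Ck_on_SucI[OF open_ball])
    fix x assume x: "x \<in> ?B"
    show "((\<lambda>x. integral {0..1::real} (\<lambda>t. t ^ m *\<^sub>R h (a + t *\<^sub>R (x - a)))) has_derivative
        blinfun_apply (integral {0..1} (D x))) (at x)"
      using leibniz_rule[OF der int contD x convex_ball] x by (simp add: at_within_open[OF x])
  next
    fix v
    have "Ck_on k ?B (\<lambda>x. integral {0..1::real} (\<lambda>t. t ^ Suc m *\<^sub>R ?h' (a + t *\<^sub>R (x - a)) v))"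
      using Suc.prems by (intro Suc.IH) simp
    then show "Ck_on k ?B (\<lambda>x. blinfun_apply (integral {0..1} (D x)) v)"
    proof (rule Ck_on_cong[OF open_ball, rotated])
      fix x assume x: "x \<in> ?B"
      \<comment> \<open>Evaluation at \<open>v\<close> is bounded and linear, so it commutes with
        the operator-valued integral and leaves an integral of the form covered by the induction
        hypothesis.\<close>
      have "blinfun_apply (integral {0..1} (D x)) v = integral {0..1} (\<lambda>t. blinfun_apply (D x t) v)"
        using integral_linear[OF intD[OF x] blinfun.bounded_linear_left[of v]] by (simp add: o_def)
      also have "\<dots> = integral {0..1} (\<lambda>t. t ^ Suc m *\<^sub>R ?h' (a + t *\<^sub>R (x - a)) v)"
        by (intro integral_cong) (simp add: D[OF x])
      finally show "integral {0..1::real} (\<lambda>t. t ^ Suc m *\<^sub>R ?h' (a + t *\<^sub>R (x - a)) v) =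
        blinfun_apply (integral {0..1} (D x)) v" by simp
    qed
  qed
qed

text \<open>Integrate the derivative of \<open>F\<close> along the segment from \<open>a\<close> to
  \<open>y\<close>; \<open>G b\<close> is the average of the partial derivative in direction
  \<open>b\<close> over that segment. At \<open>y = a\<close> the integrand is constant, which gives
  the value of \<open>G b\<close> there.\<close>

lemma Hadamard:
  fixes F :: "'b::euclidean_space \<Rightarrow> real"
  assumes "smooth_on (ball a r) F" "r > 0"
  obtains G where "\<And>b. smooth_on (ball a r) (G b)"
    "\<And>b. G b a = frechet_derivative F (at a) b"
    "\<And>y. y \<in> ball a r \<Longrightarrow> F y = F a + (\<Sum>b\<in>Basis. ((y - a) \<bullet> b) * G b y)"
proof
  let ?B = "ball a r" and ?F' = "\<lambda>y. frechet_derivative F (at y)"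
  let ?G = "\<lambda>b x. integral {0..1::real} (\<lambda>t. ?F' (a + t *\<^sub>R (x - a)) b)"
  have smF': "smooth_on ?B (\<lambda>x. ?F' x b)" for b
    by (rule smooth_on_frechet_derivative[OF assms(1)])
  show "smooth_on ?B (?G b)" for b
    using smF'[of b] Ck_on_segment_integral[where m = 0] by (fastforce simp: smooth_on_def)
  show "?G b a = ?F' a b" for b by simp
  fix y assume y: "y \<in> ?B"
  have "((\<lambda>t. F (a + t *\<^sub>R (y - a))) has_vector_derivative ?F' (a + t *\<^sub>R (y - a)) (y - a))
      (at t within {0..1})" if t: "t \<in> {0..1}" for t
  proof -
    have 1: "((\<lambda>t. a + t *\<^sub>R (y - a)) has_vector_derivative (y - a)) (at t within {0..1})"
      by (auto intro!: derivative_eq_intros)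
    have "(F has_derivative ?F' (a + t *\<^sub>R (y - a))) (at (a + t *\<^sub>R (y - a)))"
      by (rule smooth_on_derivative[OF assms(1) segment_in_ball[OF y t]])
    from vector_derivative_diff_chain_within[OF 1 has_derivative_at_withinI[OF this]]
    show ?thesis by (simp add: o_def)
  qed
  from fundamental_theorem_of_calculus[OF _ this]
  have ftc: "((\<lambda>t. ?F' (a + t *\<^sub>R (y - a)) (y - a)) has_integral F y - F a) {0..1}"
    by fastforce
  have "(\<lambda>t. ?F' (a + t *\<^sub>R (y - a)) b) integrable_on {0..1::real}" for b
  proof -
    have "continuous_on ?B (\<lambda>x. ?F' x b)"
      using smF'[of b] by (auto simp: smooth_on_def intro: Ck_on_continuous)
    then have "continuous_on {0..1::real} (\<lambda>t. ?F' (a + t *\<^sub>R (y - a)) b)"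
      by (rule continuous_on_compose2) (use segment_in_ball[OF y] in \<open>auto intro!: continuous_intros\<close>)
    then show ?thesis by (rule integrable_continuous_interval)
  qed
  then have "((\<lambda>t. ?F' (a + t *\<^sub>R (y - a)) b) has_integral ?G b y) {0..1}" for b
    by (rule integrable_integral)
  then have "((\<lambda>t. \<Sum>b\<in>Basis. ((y - a) \<bullet> b) * ?F' (a + t *\<^sub>R (y - a)) b) has_integral
      (\<Sum>b\<in>Basis. ((y - a) \<bullet> b) * ?G b y)) {0..1}"
    by (intro has_integral_sum has_integral_mult_right) auto
  moreover have "?F' (a + t *\<^sub>R (y - a)) (y - a) =
      (\<Sum>b\<in>Basis. ((y - a) \<bullet> b) * ?F' (a + t *\<^sub>R (y - a)) b)" if "t \<in> {0..1}" for t
    unfolding real_scaleR_def[symmetric]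
    by (rule linear_Basis_expansion[OF has_derivative_linear[OF
          smooth_on_derivative[OF assms(1) segment_in_ball[OF y that]]]])
  ultimately have "((\<lambda>t. ?F' (a + t *\<^sub>R (y - a)) (y - a)) has_integral
      (\<Sum>b\<in>Basis. ((y - a) \<bullet> b) * ?G b y)) {0..1}"
    by (subst has_integral_cong) auto
  from has_integral_unique[OF ftc this]
  show "F y = F a + (\<Sum>b\<in>Basis. ((y - a) \<bullet> b) * ?G b y)" by simp
qed

section \<open>Smooth functions on a manifold\<close>

locale smooth_manifold =
  fixes \<A> :: "('a::{t2_space,second_countable_topology}, 'b::euclidean_space) atlas"
  assumes atlas: "smooth_atlas \<A>"
begin

lemma chart_cover:
  obtains U \<phi> where "(U, \<phi>) \<in> \<A>" "p \<in> U"
proof -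
  have "p \<in> (\<Union>(U, \<phi>)\<in>\<A>. U)" using atlas unfolding smooth_atlas_def by simp
  then show thesis using that by auto
qed

lemma chart_homeomorphism:
  "(U, \<phi>) \<in> \<A> \<Longrightarrow> homeomorphism U (\<phi> ` U) \<phi> (inv_into U \<phi>)"
  using atlas unfolding smooth_atlas_def by auto

lemma chart_open: "(U, \<phi>) \<in> \<A> \<Longrightarrow> open U"
  using atlas unfolding smooth_atlas_def by auto

lemma chart_inverse: "(U, \<phi>) \<in> \<A> \<Longrightarrow> p \<in> U \<Longrightarrow> inv_into U \<phi> (\<phi> p) = p"
  using chart_homeomorphism by (blast intro: homeomorphism_apply1)

lemma chart_image_open:
  assumes "(U, \<phi>) \<in> \<A>" "open W"
  shows "open (\<phi> ` (U \<inter> W))"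
proof -
  have "openin (top_of_set (\<phi> ` U)) (\<phi> ` (U \<inter> W))"
    using chart_homeomorphism[OF assms(1)] assms(2)
    by (intro homeomorphism_imp_open_map) auto
  moreover have "open (\<phi> ` U)" using atlas assms(1) unfolding smooth_atlas_def by auto
  ultimately show ?thesis by (simp add: openin_open_eq)
qed

lemma chart_preimage_open:
  assumes "(U, \<phi>) \<in> \<A>" "open B"
  shows "open (U \<inter> \<phi> -` B)"
  using continuous_open_preimage[OF homeomorphism_cont1[OF chart_homeomorphism]] assms chart_open
  by blast

lemma chart_transition:
  assumes "(U, \<phi>) \<in> \<A>" "(V, \<psi>) \<in> \<A>"
  shows "smooth_on (\<phi> ` (U \<inter> V)) (\<lambda>y. \<psi> (inv_into U \<phi> y))"
  using atlas assms unfolding smooth_atlas_def o_def by fast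

lemma msmooth_onD:
  "msmooth_on \<A> W f \<Longrightarrow> (U, \<phi>) \<in> \<A> \<Longrightarrow> smooth_on (\<phi> ` (U \<inter> W)) (\<lambda>y. f (inv_into U \<phi> y))"
  unfolding msmooth_on_def o_def by auto

lemma msmooth_onI:
  "(\<And>U \<phi>. (U, \<phi>) \<in> \<A> \<Longrightarrow> smooth_on (\<phi> ` (U \<inter> W)) (\<lambda>y. f (inv_into U \<phi> y))) \<Longrightarrow> msmooth_on \<A> W f"
  unfolding msmooth_on_def o_def by auto

lemma msmooth_on_cong:
  assumes "open W" "\<And>p. p \<in> W \<Longrightarrow> f p = g p" "msmooth_on \<A> W f"
  shows "msmooth_on \<A> W g"
proof (rule msmooth_onI)
  fix U \<phi> assume c: "(U, \<phi>) \<in> \<A>"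
  show "smooth_on (\<phi> ` (U \<inter> W)) (\<lambda>y. g (inv_into U \<phi> y))"
    using chart_inverse[OF c] assms(2)
    by (intro smooth_on_cong[OF chart_image_open[OF c assms(1)] _ msmooth_onD[OF assms(3) c]]) auto
qed

lemma msmooth_on_subset: "msmooth_on \<A> W f \<Longrightarrow> V \<subseteq> W \<Longrightarrow> msmooth_on \<A> V f"
  by (intro msmooth_onI) (blast dest: msmooth_onD intro: smooth_on_subset)

lemma msmooth_on_const: "msmooth_on \<A> W (\<lambda>_. c)"
  by (simp add: msmooth_onI smooth_on_const)

lemma msmooth_on_add:
  "open W \<Longrightarrow> msmooth_on \<A> W f \<Longrightarrow> msmooth_on \<A> W g \<Longrightarrow> msmooth_on \<A> W (\<lambda>p. f p + g p)"
  by (rule msmooth_onI, rule smooth_on_add) (auto intro: chart_image_open msmooth_onD)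

lemma msmooth_on_scaleR:
  "open W \<Longrightarrow> msmooth_on \<A> W f \<Longrightarrow> msmooth_on \<A> W g \<Longrightarrow> msmooth_on \<A> W (\<lambda>p. f p *\<^sub>R g p)"
  by (rule msmooth_onI, rule smooth_on_scaleR) (auto intro: chart_image_open msmooth_onD)

lemma msmooth_on_mult:
  fixes f g :: "'a \<Rightarrow> real"
  shows "open W \<Longrightarrow> msmooth_on \<A> W f \<Longrightarrow> msmooth_on \<A> W g \<Longrightarrow> msmooth_on \<A> W (\<lambda>p. f p * g p)"
  using msmooth_on_scaleR[of W f g] by simp

lemma msmooth_on_linear:
  fixes f :: "'a \<Rightarrow> 'c::euclidean_space"
  shows "open W \<Longrightarrow> bounded_linear L \<Longrightarrow> msmooth_on \<A> W f \<Longrightarrow> msmooth_on \<A> W (\<lambda>p. L (f p))"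
  by (rule msmooth_onI, rule smooth_on_linear) (auto intro: chart_image_open msmooth_onD)

lemma msmooth_on_diff:
  fixes f g :: "'a \<Rightarrow> real"
  shows "open W \<Longrightarrow> msmooth_on \<A> W f \<Longrightarrow> msmooth_on \<A> W g \<Longrightarrow> msmooth_on \<A> W (\<lambda>p. f p - g p)"
  using msmooth_on_add[of W f "\<lambda>p. (- 1) * g p"] msmooth_on_mult[OF _ msmooth_on_const, of W g "- 1"]
  by simp

lemma msmooth_on_sum:
  "open W \<Longrightarrow> (\<And>i. i \<in> I \<Longrightarrow> msmooth_on \<A> W (f i)) \<Longrightarrow> msmooth_on \<A> W (\<lambda>p. \<Sum>i\<in>I. f i p)"
  by (rule msmooth_onI, rule smooth_on_sum) (auto intro: chart_image_open msmooth_onD)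

text \<open>One chart containing \<open>W\<close> suffices: the expression of \<open>f\<close> in
  any other chart is its expression in this one composed with a smooth transition map.\<close>

lemma msmooth_on_chartI:
  assumes U: "(U, \<phi>) \<in> \<A>" and W: "open W" "W \<subseteq> U"
    and f: "smooth_on (\<phi> ` W) (\<lambda>y. f (inv_into U \<phi> y))"
  shows "msmooth_on \<A> W f"
proof (rule msmooth_onI)
  fix V \<psi> assume V: "(V, \<psi>) \<in> \<A>"
  have oV: "open (\<psi> ` (V \<inter> W))" by (rule chart_image_open[OF V W(1)])
  have oU: "open (\<phi> ` W)"
    using chart_image_open[OF U W(1)] W(2) by (simp add: Int_absorb1)
  have "smooth_on (\<psi> ` (V \<inter> W)) (\<lambda>y. f (inv_into U \<phi> (\<phi> (inv_into V \<psi> y))))"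
  proof (rule smooth_on_compose[OF oV oU _ f])
    show "(\<lambda>y. \<phi> (inv_into V \<psi> y)) ` \<psi> ` (V \<inter> W) \<subseteq> \<phi> ` W"
      using chart_inverse[OF V] by auto
    show "smooth_on (\<psi> ` (V \<inter> W)) (\<lambda>y. \<phi> (inv_into V \<psi> y))"
      using W(2) by (intro smooth_on_subset[OF chart_transition[OF V U]]) auto
  qed
  then show "smooth_on (\<psi> ` (V \<inter> W)) (\<lambda>y. f (inv_into V \<psi> y))"
    by (rule smooth_on_cong[OF oV, rotated])
      (use W(2) in \<open>auto simp: chart_inverse[OF V] chart_inverse[OF U]\<close>)
qed

lemma msmooth_on_coordinate:
  assumes "(U, \<phi>) \<in> \<A>"
  shows "msmooth_on \<A> U (\<lambda>p. \<phi> p \<bullet> b)"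
proof (rule msmooth_on_chartI[OF assms chart_open[OF assms] order_refl])
  show "smooth_on (\<phi> ` U) (\<lambda>y. \<phi> (inv_into U \<phi> y) \<bullet> b)"
    \<comment> \<open>The coordinate expression of a chart in itself is treated as the transition
      map from the chart to itself.\<close>
    using smooth_on_linear[OF _ bounded_linear_inner_left chart_transition[OF assms assms]]
      chart_image_open[OF assms open_UNIV] by simp
qed

lemma smooth_nearI: "open W \<Longrightarrow> p \<in> W \<Longrightarrow> msmooth_on \<A> W f \<Longrightarrow> smooth_near \<A> p f"
  unfolding smooth_near_def by blast

lemma smooth_near_chartE:
  assumes "smooth_near \<A> p f" "(U, \<phi>) \<in> \<A>" "p \<in> U"
  obtains W where "open W" "p \<in> W" "W \<subseteq> U" "msmooth_on \<A> W f" "open (\<phi> ` W)"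
    "smooth_on (\<phi> ` W) (\<lambda>y. f (inv_into U \<phi> y))"
proof -
  obtain W where W: "open W" "p \<in> W" "msmooth_on \<A> W f"
    using assms(1) unfolding smooth_near_def by blast
  show thesis
    using W assms chart_open[OF assms(2)] chart_image_open[OF assms(2)] msmooth_onD[OF W(3) assms(2)]
    by (intro that[of "U \<inter> W"]) (auto intro: msmooth_on_subset)
qed

lemma smooth_near2E:
  assumes "smooth_near \<A> p f" "smooth_near \<A> p g"
  obtains W where "open W" "p \<in> W" "msmooth_on \<A> W f" "msmooth_on \<A> W g"
proof -
  obtain V W where "open V" "p \<in> V" "msmooth_on \<A> V f" "open W" "p \<in> W" "msmooth_on \<A> W g"
    using assms unfolding smooth_near_def by blast
  then show thesis by (intro that[of "V \<inter> W"]) (auto intro: msmooth_on_subset)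
qed

lemma smooth_near_cong:
  assumes "open W" "p \<in> W" "\<And>x. x \<in> W \<Longrightarrow> f x = g x" "smooth_near \<A> p f"
  shows "smooth_near \<A> p g"
proof -
  obtain V where "open V" "p \<in> V" "msmooth_on \<A> V f"
    using assms(4) unfolding smooth_near_def by blast
  then show ?thesis
    using assms by (intro smooth_nearI[of "V \<inter> W"] msmooth_on_cong[of _ f g])
      (auto intro: msmooth_on_subset)
qed

lemma smooth_near_const: "smooth_near \<A> p (\<lambda>_. c)"
  by (rule smooth_nearI[OF open_UNIV]) (auto simp: msmooth_on_const)

lemma smooth_near_add:
  "smooth_near \<A> p f \<Longrightarrow> smooth_near \<A> p g \<Longrightarrow> smooth_near \<A> p (\<lambda>x. f x + g x)"
  by (erule (1) smooth_near2E) (auto intro: smooth_nearI msmooth_on_add)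

lemma smooth_near_diff:
  "smooth_near \<A> p f \<Longrightarrow> smooth_near \<A> p g \<Longrightarrow> smooth_near \<A> p (\<lambda>x. f x - g x)"
  by (erule (1) smooth_near2E) (auto intro: smooth_nearI msmooth_on_diff)

lemma smooth_near_mult:
  "smooth_near \<A> p f \<Longrightarrow> smooth_near \<A> p g \<Longrightarrow> smooth_near \<A> p (\<lambda>x. f x * g x)"
  by (erule (1) smooth_near2E) (auto intro: smooth_nearI msmooth_on_mult)

lemma smooth_near_sum:
  "(\<And>i. i \<in> I \<Longrightarrow> smooth_near \<A> p (f i)) \<Longrightarrow> smooth_near \<A> p (\<lambda>x. \<Sum>i\<in>I. f i x)"
  by (induction I rule: infinite_finite_induct) (auto intro: smooth_near_add simp: smooth_near_const)

lemma smooth_near_coordinate: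
  "(U, \<phi>) \<in> \<A> \<Longrightarrow> p \<in> U \<Longrightarrow> smooth_near \<A> p (\<lambda>x. \<phi> x \<bullet> b)"
  by (rule smooth_nearI[OF chart_open _ msmooth_on_coordinate])

section \<open>Tangent vectors\<close>

lemma tangent_add:
  "v \<in> tangent_space \<A> p \<Longrightarrow> smooth_near \<A> p f \<Longrightarrow> smooth_near \<A> p g \<Longrightarrow>
    v (\<lambda>x. f x + g x) = v f + v g"
  unfolding tangent_space_def by blast

lemma tangent_mult:
  "v \<in> tangent_space \<A> p \<Longrightarrow> smooth_near \<A> p f \<Longrightarrow> smooth_near \<A> p g \<Longrightarrow>
    v (\<lambda>x. f x * g x) = v f * g p + f p * v g"
  unfolding tangent_space_def by blast

lemma tangent_scale:
  "v \<in> tangent_space \<A> p \<Longrightarrow> smooth_near \<A> p f \<Longrightarrow> v (\<lambda>x. c * f x) = c * v f"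
  unfolding tangent_space_def by blast

lemma tangent_not_smooth: "v \<in> tangent_space \<A> p \<Longrightarrow> \<not> smooth_near \<A> p f \<Longrightarrow> v f = 0"
  unfolding tangent_space_def by blast

lemma tangent_diff:
  "v \<in> tangent_space \<A> p \<Longrightarrow> smooth_near \<A> p f \<Longrightarrow> smooth_near \<A> p g \<Longrightarrow>
    v (\<lambda>x. f x - g x) = v f - v g"
  using tangent_add[of v p f "\<lambda>x. (- 1) * g x"] tangent_scale[of v p g "- 1"]
    smooth_near_mult[OF smooth_near_const[of p "- 1"], of g]
  by simp

lemma tangent_const:
  assumes "v \<in> tangent_space \<A> p"
  shows "v (\<lambda>_. c) = 0"
proof -
  \<comment> \<open>The product rule for 1 = 1 * 1 makes this value equal to its own double.\<close>
  have "v (\<lambda>_. 1) = 0"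
    using tangent_mult[OF assms smooth_near_const[of p 1] smooth_near_const[of p 1]] by simp
  then show ?thesis
    using tangent_scale[OF assms smooth_near_const[of p 1], of c] by simp
qed

lemma tangent_sum:
  assumes "v \<in> tangent_space \<A> p" "\<And>i. i \<in> I \<Longrightarrow> smooth_near \<A> p (f i)"
  shows "v (\<lambda>x. \<Sum>i\<in>I. f i x) = (\<Sum>i\<in>I. v (f i))"
  using assms(2)
  by (induction I rule: infinite_finite_induct)
    (auto simp: tangent_const[OF assms(1)] tangent_add[OF assms(1)] smooth_near_sum)

text \<open>No bump functions are needed here: the indicator function of \<open>W\<close> is smooth near \<open>p\<close>.\<close>

lemma tangent_cong:
  assumes v: "v \<in> tangent_space \<A> p" and W: "open W" "p \<in> W" "\<And>x. x \<in> W \<Longrightarrow> f x = g x"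
  shows "v f = v g"
proof (cases "smooth_near \<A> p f")
  case f: True
  have g: "smooth_near \<A> p g" by (rule smooth_near_cong[OF W f])
  let ?\<chi> = "indicat_real W"
  have \<chi>: "smooth_near \<A> p ?\<chi>"
    by (rule smooth_near_cong[OF W(1,2) _ smooth_near_const[of p 1]]) simp
  have "(\<lambda>x. (f x - g x) * ?\<chi> x) = (\<lambda>x. 0)"
    using W(3) by (intro ext) (simp split: split_indicator)
  then have "v (\<lambda>x. (f x - g x) * ?\<chi> x) = 0"
    using tangent_const[OF v, of 0] by simp
  then have "v (\<lambda>x. f x - g x) = 0"
    using tangent_mult[OF v smooth_near_diff[OF f g] \<chi>] W(2,3) by simp
  then show ?thesis by (simp add: tangent_diff[OF v f g])
next
  case False
  have "\<not> smooth_near \<A> p g"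
    using smooth_near_cong[OF W(1,2), of g f] W(3) False by auto
  then show ?thesis using tangent_not_smooth[OF v] False by simp
qed

section \<open>Tangent vectors as directional derivatives in a chart\<close>

definition coords :: "('a \<Rightarrow> 'b) \<Rightarrow> 'a tvec \<Rightarrow> 'b" where
  "coords \<phi> v = (\<Sum>b\<in>Basis. v (\<lambda>x. \<phi> x \<bullet> b) *\<^sub>R b)"

text \<open>The directional derivative along \<open>w\<close> in the chart, intended as the inverse
  of \<open>coords \<phi>\<close> on the tangent space at \<open>p\<close>. The default 0 matches
  the value that \<open>tangent_space\<close> prescribes on functions not smooth near
  \<open>p\<close>.\<close>

definition coord_vec :: "'a set \<Rightarrow> ('a \<Rightarrow> 'b) \<Rightarrow> 'a \<Rightarrow> 'b \<Rightarrow> 'a tvec" where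
  "coord_vec U \<phi> p w f =
    (if smooth_near \<A> p f then frechet_derivative (\<lambda>y. f (inv_into U \<phi> y)) (at (\<phi> p)) w else 0)"

lemma coords_inner: "b \<in> Basis \<Longrightarrow> coords \<phi> v \<bullet> b = v (\<lambda>x. \<phi> x \<bullet> b)"
  by (simp add: coords_def)

lemma coords_add: "coords \<phi> (\<lambda>f. v f + w f) = coords \<phi> v + coords \<phi> w"
  by (simp add: coords_def scaleR_add_left sum.distrib)

lemma coords_scale: "coords \<phi> (\<lambda>f. c * v f) = c *\<^sub>R coords \<phi> v"
  by (simp add: coords_def scaleR_sum_right)

lemma chart_derivative:
  assumes "smooth_near \<A> p f" "(U, \<phi>) \<in> \<A>" "p \<in> U"
  shows "((\<lambda>y. f (inv_into U \<phi> y)) has_derivative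
    frechet_derivative (\<lambda>y. f (inv_into U \<phi> y)) (at (\<phi> p))) (at (\<phi> p))"
  by (rule smooth_near_chartE[OF assms]) (auto intro: smooth_on_derivative)

lemma coord_vec_linear:
  assumes "(U, \<phi>) \<in> \<A>" "p \<in> U"
  shows "linear (\<lambda>w. coord_vec U \<phi> p w f)"
proof (cases "smooth_near \<A> p f")
  case True
  from chart_derivative[OF this assms, THEN has_derivative_linear] True show ?thesis
    by (simp add: coord_vec_def)
next
  case False
  then show ?thesis by (simp add: coord_vec_def linear_iff)
qed

lemma coord_vec_tangent:
  assumes U: "(U, \<phi>) \<in> \<A>" "p \<in> U"
  shows "coord_vec U \<phi> p w \<in> tangent_space \<A> p"
proof -
  let ?F = "\<lambda>f y. f (inv_into U \<phi> y) :: real"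
  let ?D = "\<lambda>f. frechet_derivative (?F f) (at (\<phi> p))"
  have inv: "inv_into U \<phi> (\<phi> p) = p" by (rule chart_inverse[OF U])
  have D: "(?F f has_derivative ?D f) (at (\<phi> p))" if "smooth_near \<A> p f" for f
    by (rule chart_derivative[OF that U])
  have "?D (\<lambda>x. f x + g x) w = ?D f w + ?D g w"
    if "smooth_near \<A> p f" "smooth_near \<A> p g" for f g
    using frechet_derivative_at[OF has_derivative_add[OF D[OF that(1)] D[OF that(2)]]]
    by (metis (no_types, lifting))
  moreover have "?D (\<lambda>x. f x * g x) w = ?D f w * g p + f p * ?D g w"
    if "smooth_near \<A> p f" "smooth_near \<A> p g" for f g
    using frechet_derivative_at[OF has_derivative_mult[OF D[OF that(1)] D[OF that(2)]]]
    by (metis (no_types, lifting) inv add.commute)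
  moreover have "?D (\<lambda>x. c * f x) w = c * ?D f w" if "smooth_near \<A> p f" for f c
    using frechet_derivative_at[OF has_derivative_mult_right[OF D[OF that], of c]]
    by (metis (no_types, lifting))
  ultimately show ?thesis
    unfolding tangent_space_def coord_vec_def
    by (auto simp: smooth_near_add smooth_near_mult smooth_near_const)
qed

lemma coords_coord_vec:
  assumes U: "(U, \<phi>) \<in> \<A>" "p \<in> U"
  shows "coords \<phi> (coord_vec U \<phi> p w) = w"
proof -
  have "coord_vec U \<phi> p w (\<lambda>x. \<phi> x \<bullet> b) = w \<bullet> b" for b
  proof -
    have op: "open (\<phi> ` U)" using chart_image_open[OF U(1) open_UNIV] by simp
    have "((\<lambda>y. y \<bullet> b) has_derivative (\<lambda>w. w \<bullet> b)) (at (\<phi> p))"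
      by (auto intro!: derivative_eq_intros)
    then have "((\<lambda>y. \<phi> (inv_into U \<phi> y) \<bullet> b) has_derivative (\<lambda>w. w \<bullet> b)) (at (\<phi> p))"
      by (rule has_derivative_transform_within_open[OF _ op])
        (use U in \<open>auto simp: chart_inverse\<close>)
    from frechet_derivative_at[OF this, symmetric] show ?thesis
      by (simp add: coord_vec_def smooth_near_coordinate[OF U])
  qed
  then show ?thesis by (simp add: coords_def euclidean_representation)
qed

text \<open>By Hadamard's lemma \<open>f\<close> is, near \<open>p\<close>, a constant plus a sum of
  products of centred coordinates with smooth functions. The centred coordinates vanish at
  \<open>p\<close>, so the product rule leaves only the values of \<open>v\<close> on the
  coordinates, weighted by the partial derivatives of \<open>f\<close>. This is injectivity of
  \<open>coords\<close>, and so the dimension bound for the tangent space.\<close>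

lemma tangent_coord_vec:
  assumes v: "v \<in> tangent_space \<A> p" and U: "(U, \<phi>) \<in> \<A>" "p \<in> U"
  shows "coord_vec U \<phi> p (coords \<phi> v) = v"
proof
  fix f
  show "coord_vec U \<phi> p (coords \<phi> v) f = v f"
  proof (cases "smooth_near \<A> p f")
    case False
    then show ?thesis by (simp add: coord_vec_def tangent_not_smooth[OF v])
  next
    case f: True
    let ?F = "\<lambda>y. f (inv_into U \<phi> y)" and ?a = "\<phi> p"
    obtain W where W: "open W" "p \<in> W" "W \<subseteq> U" "open (\<phi> ` W)" "smooth_on (\<phi> ` W) ?F"
      by (rule smooth_near_chartE[OF f U])
    obtain r where r: "r > 0" "ball ?a r \<subseteq> \<phi> ` W"
      using W(2,4) by (meson imageI open_contains_ball)
    obtain G where G: "\<And>b. smooth_on (ball ?a r) (G b)"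
      "\<And>b. G b ?a = frechet_derivative ?F (at ?a) b"
      "\<And>y. y \<in> ball ?a r \<Longrightarrow> ?F y = ?F ?a + (\<Sum>b\<in>Basis. ((y - ?a) \<bullet> b) * G b y)"
      using Hadamard[OF smooth_on_subset[OF W(5) r(2)] r(1)] by blast
    \<comment> \<open>The preimage of the ball is where the expansion is valid;
      \<open>tangent_cong\<close> makes the behaviour of both sides elsewhere irrelevant.\<close>
    define B where "B = U \<inter> \<phi> -` ball ?a r"
    have B: "open B" "p \<in> B" "B \<subseteq> U"
      using chart_preimage_open[OF U(1) open_ball] U r(1) by (auto simp: B_def)
    have nG: "smooth_near \<A> p (\<lambda>x. G b (\<phi> x))" for b
    proof (rule smooth_nearI[OF B(1,2) msmooth_on_chartI[OF U(1) B(1,3)]])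
      have oB: "open (\<phi> ` B)" using chart_image_open[OF U(1) B(1)] B(3) by (simp add: Int_absorb1)
      have "smooth_on (\<phi> ` B) (G b)"
        by (rule smooth_on_subset[OF G(1)]) (auto simp: B_def)
      then show "smooth_on (\<phi> ` B) (\<lambda>y. G b (\<phi> (inv_into U \<phi> y)))"
        by (rule smooth_on_cong[OF oB, rotated]) (use B(3) in \<open>auto simp: chart_inverse[OF U(1)]\<close>)
    qed
    have nx: "smooth_near \<A> p (\<lambda>x. \<phi> x \<bullet> b - ?a \<bullet> b)" for b
      by (rule smooth_near_diff[OF smooth_near_coordinate[OF U] smooth_near_const])
    have nt: "smooth_near \<A> p (\<lambda>x. (\<phi> x \<bullet> b - ?a \<bullet> b) * G b (\<phi> x))" for b
      by (rule smooth_near_mult[OF nx nG])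
    have v_term: "v (\<lambda>x. (\<phi> x \<bullet> b - ?a \<bullet> b) * G b (\<phi> x)) = v (\<lambda>x. \<phi> x \<bullet> b) * G b ?a" for b
      using tangent_mult[OF v nx nG]
        tangent_diff[OF v smooth_near_coordinate[OF U] smooth_near_const] tangent_const[OF v]
      by simp
    have "v f = v (\<lambda>x. f p + (\<Sum>b\<in>Basis. (\<phi> x \<bullet> b - ?a \<bullet> b) * G b (\<phi> x)))"
    proof (rule tangent_cong[OF v B(1,2)])
      fix x assume "x \<in> B"
      then show "f x = f p + (\<Sum>b\<in>Basis. (\<phi> x \<bullet> b - ?a \<bullet> b) * G b (\<phi> x))"
        using G(3)[of "\<phi> x"] U
        by (simp add: B_def chart_inverse[OF U(1)] inner_diff_left)
    qed
    also have "\<dots> = (\<Sum>b\<in>Basis. v (\<lambda>x. (\<phi> x \<bullet> b - ?a \<bullet> b) * G b (\<phi> x)))"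
      by (subst tangent_add[OF v smooth_near_const smooth_near_sum[OF nt]])
        (simp add: tangent_sum[OF v nt] tangent_const[OF v])
    also have "\<dots> = (\<Sum>b\<in>Basis. (coords \<phi> v \<bullet> b) *\<^sub>R frechet_derivative ?F (at ?a) b)"
      by (intro sum.cong) (simp_all add: v_term G(2) coords_inner)
    also have "\<dots> = frechet_derivative ?F (at ?a) (coords \<phi> v)"
      by (rule linear_Basis_expansion[OF has_derivative_linear[OF chart_derivative[OF f U]], symmetric])
    finally show ?thesis using f by (simp add: coord_vec_def)
  qed
qed

lemma bij_betw_coords:
  assumes "(U, \<phi>) \<in> \<A>" "p \<in> U"
  shows "bij_betw (coords \<phi>) (tangent_space \<A> p) UNIV"
  by (rule bij_betw_byWitness[of _ "coord_vec U \<phi> p"])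
    (auto simp: tangent_coord_vec[OF _ assms] coords_coord_vec[OF assms] coord_vec_tangent[OF assms])

text \<open>Bundle and bundle map axioms speak of the choice-based inverse of a trivialisation. This
  explicit form makes its smooth dependence on \<open>p\<close> accessible.\<close>

lemma inv_into_coords:
  assumes "(U, \<phi>) \<in> \<A>" "p \<in> U"
  shows "inv_into (tangent_space \<A> p) (coords \<phi>) w = coord_vec U \<phi> p w"
  using bij_betw_coords[OF assms] coord_vec_tangent[OF assms] coords_coord_vec[OF assms]
  by (metis bij_betw_imp_inj_on inv_into_f_f)

lemma msmooth_on_coord_vec:
  assumes U: "(U, \<phi>) \<in> \<A>" and W: "open W" "W \<subseteq> U" and f: "msmooth_on \<A> W f"
  shows "msmooth_on \<A> W (\<lambda>p. coord_vec U \<phi> p w f)"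
proof (rule msmooth_on_chartI[OF U W])
  have op: "open (\<phi> ` W)" using chart_image_open[OF U W(1)] W(2) by (simp add: Int_absorb1)
  have "smooth_on (\<phi> ` W) (\<lambda>y. f (inv_into U \<phi> y))"
    using msmooth_onD[OF f U] W(2) by (simp add: Int_absorb1)
  from smooth_on_frechet_derivative[OF this]
  have "smooth_on (\<phi> ` W) (\<lambda>y. frechet_derivative (\<lambda>y. f (inv_into U \<phi> y)) (at y) w)" .
  then show "smooth_on (\<phi> ` W) (\<lambda>y. coord_vec U \<phi> (inv_into U \<phi> y) w f)"
    by (rule smooth_on_cong[OF op, rotated])
      (use W smooth_nearI[OF W(1) _ f] in
        \<open>auto simp: coord_vec_def chart_inverse[OF U] subset_iff\<close>)
qed

text \<open>This family is the Jacobian of the transition map from \<open>\<phi>\<close> to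
  \<open>\<psi>\<close> applied to \<open>w\<close>, so its components are directional derivatives
  of smooth coordinate functions.\<close>

lemma msmooth_on_coords_coord_vec:
  assumes "(U, \<phi>) \<in> \<A>" "(V, \<psi>) \<in> \<A>"
  shows "msmooth_on \<A> (U \<inter> V) (\<lambda>p. coords \<psi> (coord_vec U \<phi> p w))"
  unfolding coords_def
  by (intro msmooth_on_sum msmooth_on_scaleR msmooth_on_const msmooth_on_coord_vec[OF assms(1)]
      open_Int chart_open[OF assms(1)] chart_open[OF assms(2)]
      msmooth_on_subset[OF msmooth_on_coordinate[OF assms(2)]]) auto

section \<open>The tangent bundle and its sections\<close>

abbreviation TM :: "('a, 'a tvec, 'b) vbundle" where "TM \<equiv> tangent_bundle \<A>"

lemma tangent_bundle_simps:
  "fibre TM = tangent_space \<A>" "vzero TM p = (\<lambda>f. 0)" "vadd TM p v w = (\<lambda>f. v f + w f)"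
  "vscale TM p c v = (\<lambda>f. c * v f)"
  by (simp_all add: tangent_bundle_def)

lemma Ball_trivs_TM:
  "(\<forall>(U, \<tau>)\<in>trivs TM. Q U \<tau>) \<longleftrightarrow> (\<forall>(U, \<phi>)\<in>\<A>. Q U (\<lambda>p. coords \<phi>))"
  unfolding tangent_bundle_def coords_def by auto

lemma tangent_space_zero: "(\<lambda>f. 0) \<in> tangent_space \<A> p"
  unfolding tangent_space_def by simp

lemma tangent_space_add:
  "v \<in> tangent_space \<A> p \<Longrightarrow> w \<in> tangent_space \<A> p \<Longrightarrow> (\<lambda>f. v f + w f) \<in> tangent_space \<A> p"
  unfolding tangent_space_def by (simp add: algebra_simps)

lemma tangent_space_scale:
  "v \<in> tangent_space \<A> p \<Longrightarrow> (\<lambda>f. c * v f) \<in> tangent_space \<A> p"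
  unfolding tangent_space_def by (simp add: algebra_simps)

lemma vector_bundle_TM: "vector_bundle \<A> TM"
proof -
  have cover: "(\<Union>(U, \<tau>)\<in>trivs TM. U) = UNIV"
  proof -
    have "p \<in> (\<Union>(U, \<tau>)\<in>trivs TM. U)" for p
      by (rule chart_cover[of p]) (auto simp: tangent_bundle_def)
    then show ?thesis by blast
  qed
  have "msmooth_on \<A> (U \<inter> V) (\<lambda>p. coords \<psi> (inv_into (tangent_space \<A> p) (coords \<phi>) w))"
    if "(U, \<phi>) \<in> \<A>" "(V, \<psi>) \<in> \<A>" for U \<phi> V \<psi> w
    by (rule msmooth_on_cong[OF _ _ msmooth_on_coords_coord_vec[OF that]])
      (use that in \<open>auto simp: inv_into_coords chart_open\<close>)
  then show ?thesis
    unfolding vector_bundle_def Ball_trivs_TM tangent_bundle_simps cover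
    \<comment> \<open>With the factor 0 this yields that \<open>coords\<close> maps the zero vector
      to 0.\<close>
    using coords_scale[of _ 0]
    by (auto simp: tangent_space_zero tangent_space_add tangent_space_scale coords_add coords_scale
        bij_betw_coords chart_open)
qed

section \<open>Vector fields and their action on functions\<close>

lemma vector_fields_iff:
  "X \<in> vector_fields \<A> \<longleftrightarrow> (\<forall>p. X p \<in> tangent_space \<A> p) \<and>
    (\<forall>(U, \<phi>)\<in>\<A>. msmooth_on \<A> U (\<lambda>p. coords \<phi> (X p)))"
  unfolding vector_fields_def sections_def Ball_trivs_TM tangent_bundle_simps by simp

lemma vector_field_tangent: "X \<in> vector_fields \<A> \<Longrightarrow> X p \<in> tangent_space \<A> p"
  by (simp add: vector_fields_iff)

lemma vector_field_coords:
  "X \<in> vector_fields \<A> \<Longrightarrow> (U, \<phi>) \<in> \<A> \<Longrightarrow> msmooth_on \<A> U (\<lambda>p. coords \<phi> (X p))"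
  by (auto simp: vector_fields_iff)

lemma vector_fieldsI:
  "(\<And>p. X p \<in> tangent_space \<A> p) \<Longrightarrow>
    (\<And>U \<phi>. (U, \<phi>) \<in> \<A> \<Longrightarrow> msmooth_on \<A> U (\<lambda>p. coords \<phi> (X p))) \<Longrightarrow> X \<in> vector_fields \<A>"
  by (auto simp: vector_fields_iff)

lemma vector_field_expansion:
  assumes X: "X \<in> vector_fields \<A>" and U: "(U, \<phi>) \<in> \<A>" "p \<in> U"
  shows "X p f = (\<Sum>b\<in>Basis. (coords \<phi> (X p) \<bullet> b) * coord_vec U \<phi> p b f)"
proof -
  have "X p f = coord_vec U \<phi> p (coords \<phi> (X p)) f"
    by (simp add: tangent_coord_vec[OF vector_field_tangent[OF X] U])
  also have "\<dots> = (\<Sum>b\<in>Basis. (coords \<phi> (X p) \<bullet> b) *\<^sub>R coord_vec U \<phi> p b f)"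
    by (rule linear_Basis_expansion[OF coord_vec_linear[OF U]])
  finally show ?thesis by simp
qed

text \<open>Over a chart domain, \<open>X\<close> is a combination of coordinate fields with smooth
  coefficients, so the derivative of \<open>f\<close> along \<open>X\<close> is a finite sum of
  products of smooth functions.\<close>

lemma msmooth_on_apply_field:
  assumes X: "X \<in> vector_fields \<A>" and W: "open W" and f: "msmooth_on \<A> W f"
  shows "msmooth_on \<A> W (apply_field X f)"
proof (rule msmooth_onI)
  fix U \<phi> assume U: "(U, \<phi>) \<in> \<A>"
  let ?g = "\<lambda>p. \<Sum>b\<in>Basis. (coords \<phi> (X p) \<bullet> b) * coord_vec U \<phi> p b f"
  have UW: "open (U \<inter> W)" using chart_open[OF U] W by blast
  have "msmooth_on \<A> (U \<inter> W) (\<lambda>p. coord_vec U \<phi> p b f)" for b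
    using UW f by (intro msmooth_on_coord_vec[OF U]) (auto intro: msmooth_on_subset)
  moreover have "msmooth_on \<A> (U \<inter> W) (\<lambda>p. coords \<phi> (X p) \<bullet> b)" for b
    by (rule msmooth_on_linear[OF UW bounded_linear_inner_left
          msmooth_on_subset[OF vector_field_coords[OF X U]]]) simp
  ultimately have "msmooth_on \<A> (U \<inter> W) ?g"
    using UW by (auto intro!: msmooth_on_sum msmooth_on_mult)
  from msmooth_on_cong[OF UW _ this, of "apply_field X f"]
  have "msmooth_on \<A> (U \<inter> W) (apply_field X f)"
    by (simp add: apply_field_def vector_field_expansion[OF X U])
  from msmooth_onD[OF this U]
  show "smooth_on (\<phi> ` (U \<inter> W)) (\<lambda>y. apply_field X f (inv_into U \<phi> y))"
    by (simp add: Int_left_absorb)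
qed

lemma smooth_near_apply_field:
  "X \<in> vector_fields \<A> \<Longrightarrow> smooth_near \<A> p f \<Longrightarrow> smooth_near \<A> p (apply_field X f)"
  unfolding smooth_near_def using msmooth_on_apply_field by blast

lemma smooth_functions_near: "f \<in> smooth_functions \<A> \<Longrightarrow> smooth_near \<A> p f"
  unfolding smooth_functions_def by (auto intro: smooth_nearI[OF open_UNIV])

lemma smooth_functions_const: "(\<lambda>_. c) \<in> smooth_functions \<A>"
  by (simp add: smooth_functions_def msmooth_on_const)

lemma smooth_functions_apply_field:
  "X \<in> vector_fields \<A> \<Longrightarrow> f \<in> smooth_functions \<A> \<Longrightarrow> apply_field X f \<in> smooth_functions \<A>"
  by (simp add: smooth_functions_def msmooth_on_apply_field)

lemma vector_fields_zero: "(\<lambda>p f. 0) \<in> vector_fields \<A>"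
  using coords_scale[of _ 0] by (intro vector_fieldsI) (simp_all add: tangent_space_zero msmooth_on_const)

lemma vector_fields_add:
  assumes "X \<in> vector_fields \<A>" "Y \<in> vector_fields \<A>"
  shows "(\<lambda>p f. X p f + Y p f) \<in> vector_fields \<A>"
  using assms
  by (intro vector_fieldsI)
    (simp_all add: vector_field_tangent tangent_space_add coords_add msmooth_on_add vector_field_coords
      chart_open)

lemma vector_fields_mult:
  assumes "X \<in> vector_fields \<A>" "f \<in> smooth_functions \<A>"
  shows "sec_mult TM f X \<in> vector_fields \<A>"
  using assms
  by (intro vector_fieldsI)
    (auto simp: vector_field_tangent tangent_space_scale coords_scale vector_field_coords
      chart_open sec_mult_def tangent_bundle_simps smooth_functions_def
      intro!: msmooth_on_scaleR intro: msmooth_on_subset)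

section \<open>The Lie bracket of vector fields\<close>

lemma Lie_bracket_apply:
  "smooth_near \<A> p f \<Longrightarrow>
    Lie_bracket \<A> X Y p f = X p (apply_field Y f) - Y p (apply_field X f)"
  by (simp add: Lie_bracket_def)

text \<open>A composition of two fields violates the product rule by the cross terms
  \<open>Z' p f * Z p g + Z p f * Z' p g\<close>. These are symmetric in the two fields, so they
  cancel in the commutator.\<close>

lemma Lie_bracket_tangent:
  assumes X: "X \<in> vector_fields \<A>" and Y: "Y \<in> vector_fields \<A>"
  shows "Lie_bracket \<A> X Y p \<in> tangent_space \<A> p"
proof -
  have add: "Z p (apply_field Z' (\<lambda>x. f x + g x)) = Z p (apply_field Z' f) + Z p (apply_field Z' g)"
    and mult: "Z p (apply_field Z' (\<lambda>x. f x * g x)) =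
      Z p (apply_field Z' f) * g p + Z' p f * Z p g + Z p f * Z' p g + f p * Z p (apply_field Z' g)"
    if f: "smooth_near \<A> p f" and g: "smooth_near \<A> p g"
      and Z: "Z \<in> vector_fields \<A>" and Z': "Z' \<in> vector_fields \<A>" for f g Z Z'
  proof -
    obtain W where W: "open W" "p \<in> W" "msmooth_on \<A> W f" "msmooth_on \<A> W g"
      by (rule smooth_near2E[OF f g])
    have near: "smooth_near \<A> q f" "smooth_near \<A> q g" if "q \<in> W" for q
      using W that by (auto intro: smooth_nearI)
    note T = vector_field_tangent[OF Z, of p] vector_field_tangent[OF Z']
    note s = f g smooth_near_apply_field[OF Z' f] smooth_near_apply_field[OF Z' g]
    have "Z p (apply_field Z' (\<lambda>x. f x + g x)) = Z p (\<lambda>q. apply_field Z' f q + apply_field Z' g q)"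
      \<comment> \<open>The inner identity is available only on \<open>W\<close>, where both
        functions are smooth, so it is applied locally under \<open>Z p\<close>.\<close>
      by (rule tangent_cong[OF T(1) W(1,2)]) (simp add: apply_field_def tangent_add[OF T(2) near])
    then show "Z p (apply_field Z' (\<lambda>x. f x + g x)) = Z p (apply_field Z' f) + Z p (apply_field Z' g)"
      by (simp add: tangent_add[OF T(1)] s)
    have "Z p (apply_field Z' (\<lambda>x. f x * g x)) =
        Z p (\<lambda>q. apply_field Z' f q * g q + f q * apply_field Z' g q)"
      by (rule tangent_cong[OF T(1) W(1,2)]) (simp add: apply_field_def tangent_mult[OF T(2) near])
    also have "\<dots> = Z p (apply_field Z' f) * g p + Z' p f * Z p g + Z p f * Z' p g
        + f p * Z p (apply_field Z' g)"
      using s by (simp add: tangent_add[OF T(1)] tangent_mult[OF T(1)] smooth_near_mult)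
        (simp add: apply_field_def)
    finally show "Z p (apply_field Z' (\<lambda>x. f x * g x)) =
      Z p (apply_field Z' f) * g p + Z' p f * Z p g + Z p f * Z' p g + f p * Z p (apply_field Z' g)" .
  qed
  have scale: "Z p (apply_field Z' (\<lambda>x. c * f x)) = c * Z p (apply_field Z' f)"
    if f: "smooth_near \<A> p f" and Z: "Z \<in> vector_fields \<A>" and Z': "Z' \<in> vector_fields \<A>"
    for f c Z Z'
    \<comment> \<open>Homogeneity is the product formula with a constant first factor, whose
      derivatives all vanish.\<close>
    using mult[OF smooth_near_const[of p c] f Z Z'] tangent_const[OF vector_field_tangent[OF Z]]
      tangent_const[OF vector_field_tangent[OF Z']]
    by (simp add: apply_field_def)
  have "Lie_bracket \<A> X Y p (\<lambda>x. c * f x) = c * Lie_bracket \<A> X Y p f"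
    if "smooth_near \<A> p f" for f c
    using smooth_near_mult[OF smooth_near_const[of p c] that]
    by (simp add: Lie_bracket_apply that scale[OF _ X Y] scale[OF _ Y X] right_diff_distrib)
  then show ?thesis
    unfolding tangent_space_def
    by (auto simp: Lie_bracket_apply smooth_near_add smooth_near_mult
        add[OF _ _ X Y] add[OF _ _ Y X] mult[OF _ _ X Y] mult[OF _ _ Y X] algebra_simps)
      (simp add: Lie_bracket_def)
qed

text \<open>The components of the bracket in a chart are its values on the coordinate functions,
  which are obtained from smooth functions by applying fields twice.\<close>

lemma vector_fields_Lie_bracket:
  assumes X: "X \<in> vector_fields \<A>" and Y: "Y \<in> vector_fields \<A>"
  shows "Lie_bracket \<A> X Y \<in> vector_fields \<A>"
proof (rule vector_fieldsI[OF Lie_bracket_tangent[OF X Y]])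
  fix U \<phi> assume U: "(U, \<phi>) \<in> \<A>"
  note oU = chart_open[OF U] and c = msmooth_on_coordinate[OF U]
  have "msmooth_on \<A> U (\<lambda>p. X p (apply_field Y (\<lambda>x. \<phi> x \<bullet> b)) - Y p (apply_field X (\<lambda>x. \<phi> x \<bullet> b)))"
    for b
    using msmooth_on_diff[OF oU msmooth_on_apply_field[OF X oU msmooth_on_apply_field[OF Y oU c]]
        msmooth_on_apply_field[OF Y oU msmooth_on_apply_field[OF X oU c]], of b b]
    by (simp add: apply_field_def)
  then have "msmooth_on \<A> U (\<lambda>p. \<Sum>b\<in>Basis.
      (X p (apply_field Y (\<lambda>x. \<phi> x \<bullet> b)) - Y p (apply_field X (\<lambda>x. \<phi> x \<bullet> b))) *\<^sub>R b)"
    by (intro msmooth_on_sum msmooth_on_scaleR msmooth_on_const oU)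
  then show "msmooth_on \<A> U (\<lambda>p. coords \<phi> (Lie_bracket \<A> X Y p))"
    by (rule msmooth_on_cong[OF oU, rotated])
      (simp add: coords_def Lie_bracket_apply smooth_near_coordinate[OF U])
qed

lemma Lie_bracket_add_right:
  assumes "X \<in> vector_fields \<A>" "Y \<in> vector_fields \<A>" "Z \<in> vector_fields \<A>"
  shows "Lie_bracket \<A> X (\<lambda>p f. Y p f + Z p f) = (\<lambda>p f. Lie_bracket \<A> X Y p f + Lie_bracket \<A> X Z p f)"
proof (intro ext)
  fix p f
  have "X p (apply_field (\<lambda>p f. Y p f + Z p f) f) = X p (apply_field Y f) + X p (apply_field Z f)"
    if "smooth_near \<A> p f"
    using tangent_add[OF vector_field_tangent[OF assms(1)]
        smooth_near_apply_field[OF assms(2) that] smooth_near_apply_field[OF assms(3) that]]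
    by (simp add: apply_field_def)
  then show "Lie_bracket \<A> X (\<lambda>p f. Y p f + Z p f) p f =
      Lie_bracket \<A> X Y p f + Lie_bracket \<A> X Z p f"
    by (simp add: Lie_bracket_def)
qed

lemma Lie_bracket_swap: "Lie_bracket \<A> Y X = (\<lambda>p f. - Lie_bracket \<A> X Y p f)"
  by (intro ext) (simp add: Lie_bracket_def)

lemma Lie_bracket_mult_right:
  assumes X: "X \<in> vector_fields \<A>" and Y: "Y \<in> vector_fields \<A>" and h: "h \<in> smooth_functions \<A>"
  shows "Lie_bracket \<A> X (sec_mult TM h Y) =
    (\<lambda>p f. h p * Lie_bracket \<A> X Y p f + apply_field X h p * Y p f)"
proof (intro ext)
  fix p f
  have "X p (apply_field (sec_mult TM h Y) f) = X p h * Y p f + h p * X p (apply_field Y f)"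
    if "smooth_near \<A> p f"
    using tangent_mult[OF vector_field_tangent[OF X] smooth_functions_near[OF h]
        smooth_near_apply_field[OF Y that]]
    by (simp add: apply_field_def sec_mult_def tangent_bundle_simps)
  \<comment> \<open>\<open>Lie_bracket\<close> is 0 on such \<open>f\<close> by definition, so the
    extra term on the right must vanish too; the default value built into tangent vectors ensures
    this.\<close>
  moreover have "Y p f = 0" if "\<not> smooth_near \<A> p f"
    by (rule tangent_not_smooth[OF vector_field_tangent[OF Y] that])
  ultimately show "Lie_bracket \<A> X (sec_mult TM h Y) p f =
      h p * Lie_bracket \<A> X Y p f + apply_field X h p * Y p f"
    by (simp add: Lie_bracket_def algebra_simps)
      (simp add: sec_mult_def tangent_bundle_simps apply_field_def)
qed

text \<open>Each double commutator expands into four threefold compositions; in the cyclic sum each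
  of the six orderings of the fields occurs twice with opposite signs.\<close>

lemma Lie_bracket_Jacobi:
  assumes X: "X \<in> vector_fields \<A>" and Y: "Y \<in> vector_fields \<A>" and Z: "Z \<in> vector_fields \<A>"
  shows "Lie_bracket \<A> X (Lie_bracket \<A> Y Z) p f + Lie_bracket \<A> Y (Lie_bracket \<A> Z X) p f
    + Lie_bracket \<A> Z (Lie_bracket \<A> X Y) p f = 0"
proof (cases "smooth_near \<A> p f")
  case f: True
  have expand: "Lie_bracket \<A> A (Lie_bracket \<A> B C) p f =
      A p (apply_field B (apply_field C f)) - A p (apply_field C (apply_field B f))
      - B p (apply_field C (apply_field A f)) + C p (apply_field B (apply_field A f))"
    if A: "A \<in> vector_fields \<A>" and B: "B \<in> vector_fields \<A>" and C: "C \<in> vector_fields \<A>" for A B C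
  proof -
    obtain W where W: "open W" "p \<in> W" "msmooth_on \<A> W f"
      using f unfolding smooth_near_def by blast
    have "A p (apply_field (Lie_bracket \<A> B C) f) =
        A p (\<lambda>q. apply_field B (apply_field C f) q - apply_field C (apply_field B f) q)"
      by (rule tangent_cong[OF vector_field_tangent[OF A] W(1,2)])
        (simp add: apply_field_def[of "Lie_bracket \<A> B C"] Lie_bracket_apply smooth_nearI[OF W(1) _ W(3)],
          simp add: apply_field_def)
    also have "\<dots> = A p (apply_field B (apply_field C f)) - A p (apply_field C (apply_field B f))"
      by (intro tangent_diff[OF vector_field_tangent[OF A]] smooth_near_apply_field B C f)
    finally show ?thesis
      by (simp add: Lie_bracket_apply f smooth_near_apply_field[OF A])
  qed
  show ?thesis by (simp add: expand X Y Z)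
qed (simp add: Lie_bracket_def)

section \<open>Endomorphisms of the tangent bundle\<close>

definition endomorphism :: "('a \<Rightarrow> 'a tvec \<Rightarrow> 'a tvec) \<Rightarrow> bool" where
  "endomorphism N \<longleftrightarrow> vbundle_map \<A> TM TM N"

lemma endomorphism_iff:
  "endomorphism N \<longleftrightarrow>
     (\<forall>p. \<forall>v\<in>tangent_space \<A> p. N p v \<in> tangent_space \<A> p) \<and>
     (\<forall>p. \<forall>v\<in>tangent_space \<A> p. \<forall>w\<in>tangent_space \<A> p.
        N p (\<lambda>f. v f + w f) = (\<lambda>f. N p v f + N p w f)) \<and>
     (\<forall>p c. \<forall>v\<in>tangent_space \<A> p. N p (\<lambda>f. c * v f) = (\<lambda>f. c * N p v f)) \<and>
     (\<forall>(U, \<phi>)\<in>\<A>. \<forall>(V, \<psi>)\<in>\<A>. \<forall>w.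
        msmooth_on \<A> (U \<inter> V) (\<lambda>p. coords \<psi> (N p (coord_vec U \<phi> p w))))"
proof -
  have *: "msmooth_on \<A> (U \<inter> V) (\<lambda>p. coords \<psi> (N p (inv_into (tangent_space \<A> p) (coords \<phi>) w))) \<longleftrightarrow>
      msmooth_on \<A> (U \<inter> V) (\<lambda>p. coords \<psi> (N p (coord_vec U \<phi> p w)))"
    if "(U, \<phi>) \<in> \<A>" "(V, \<psi>) \<in> \<A>" for U \<phi> V \<psi> w
  proof -
    have op: "open (U \<inter> V)" using that chart_open by blast
    show ?thesis
      by (rule iffI; erule msmooth_on_cong[OF op, rotated]) (simp_all add: inv_into_coords[OF that(1)])
  qed
  have ball_eq: "(\<forall>(U, \<phi>)\<in>\<A>. \<forall>(V, \<psi>)\<in>\<A>. L U \<phi> V \<psi>) \<longleftrightarrow> (\<forall>(U, \<phi>)\<in>\<A>. \<forall>(V, \<psi>)\<in>\<A>. R U \<phi> V \<psi>)"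
    if "\<And>U \<phi> V \<psi>. (U, \<phi>) \<in> \<A> \<Longrightarrow> (V, \<psi>) \<in> \<A> \<Longrightarrow> L U \<phi> V \<psi> = R U \<phi> V \<psi>" for L R
    using that by fast
  have "(\<forall>(U, \<phi>)\<in>\<A>. \<forall>(V, \<psi>)\<in>\<A>. \<forall>w.
        msmooth_on \<A> (U \<inter> V) (\<lambda>p. coords \<psi> (N p (inv_into (tangent_space \<A> p) (coords \<phi>) w)))) \<longleftrightarrow>
      (\<forall>(U, \<phi>)\<in>\<A>. \<forall>(V, \<psi>)\<in>\<A>. \<forall>w.
        msmooth_on \<A> (U \<inter> V) (\<lambda>p. coords \<psi> (N p (coord_vec U \<phi> p w))))"
    by (rule ball_eq) (simp add: *)
  then show ?thesis
    unfolding endomorphism_def vbundle_map_def Ball_trivs_TM tangent_bundle_simps by simp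
qed

lemma endomorphism_tangent: "endomorphism N \<Longrightarrow> v \<in> tangent_space \<A> p \<Longrightarrow> N p v \<in> tangent_space \<A> p"
  by (simp add: endomorphism_iff)

lemma endomorphism_add:
  "endomorphism N \<Longrightarrow> v \<in> tangent_space \<A> p \<Longrightarrow> w \<in> tangent_space \<A> p \<Longrightarrow>
    N p (\<lambda>f. v f + w f) = (\<lambda>f. N p v f + N p w f)"
  by (simp add: endomorphism_iff)

lemma endomorphism_scale:
  "endomorphism N \<Longrightarrow> v \<in> tangent_space \<A> p \<Longrightarrow> N p (\<lambda>f. c * v f) = (\<lambda>f. c * N p v f)"
  by (simp add: endomorphism_iff)

lemma endomorphism_matrix:
  "endomorphism N \<Longrightarrow> (U, \<phi>) \<in> \<A> \<Longrightarrow> (V, \<psi>) \<in> \<A> \<Longrightarrow>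
    msmooth_on \<A> (U \<inter> V) (\<lambda>p. coords \<psi> (N p (coord_vec U \<phi> p w)))"
  unfolding endomorphism_iff by fast

text \<open>In a chart the components of the image field are the matrix of \<open>N\<close> applied
  to the components of \<open>X\<close>. The matrix entries are smooth by the bundle map condition
  with the same chart on both sides.\<close>

lemma on_sections_vector_fields:
  assumes N: "endomorphism N" and X: "X \<in> vector_fields \<A>"
  shows "on_sections N X \<in> vector_fields \<A>"
proof (rule vector_fieldsI)
  show "on_sections N X p \<in> tangent_space \<A> p" for p
    by (simp add: on_sections_def endomorphism_tangent[OF N] vector_field_tangent[OF X])
next
  fix U \<phi> assume U: "(U, \<phi>) \<in> \<A>"
  let ?M = "\<lambda>p w. coords \<phi> (N p (coord_vec U \<phi> p w))"
  have oU: "open U" by (rule chart_open[OF U])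
  have "msmooth_on \<A> U (\<lambda>p. \<Sum>b\<in>Basis. (coords \<phi> (X p) \<bullet> b) *\<^sub>R ?M p b)"
    using endomorphism_matrix[OF N U U]
    by (intro msmooth_on_sum msmooth_on_scaleR oU
        msmooth_on_linear[OF oU bounded_linear_inner_left vector_field_coords[OF X U]]) simp
  then show "msmooth_on \<A> U (\<lambda>p. coords \<phi> (on_sections N X p))"
  proof (rule msmooth_on_cong[OF oU, rotated])
    fix p assume p: "p \<in> U"
    have "linear (?M p)"
    proof (rule linearI)
      fix v w c
      have "coord_vec U \<phi> p (v + w) = (\<lambda>f. coord_vec U \<phi> p v f + coord_vec U \<phi> p w f)"
        using linear_add[OF coord_vec_linear[OF U p]] by blast
      then show "?M p (v + w) = ?M p v + ?M p w"
        by (simp add: endomorphism_add[OF N] coord_vec_tangent[OF U p] coords_add)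
      have "coord_vec U \<phi> p (c *\<^sub>R v) = (\<lambda>f. c * coord_vec U \<phi> p v f)"
        using linear_scale[OF coord_vec_linear[OF U p]] by fastforce
      then show "?M p (c *\<^sub>R v) = c *\<^sub>R ?M p v"
        by (simp add: endomorphism_scale[OF N] coord_vec_tangent[OF U p] coords_scale)
    qed
    from linear_Basis_expansion[OF this, of "coords \<phi> (X p)", symmetric]
    show "(\<Sum>b\<in>Basis. (coords \<phi> (X p) \<bullet> b) *\<^sub>R ?M p b) = coords \<phi> (on_sections N X p)"
      by (simp add: on_sections_def tangent_coord_vec[OF vector_field_tangent[OF X] U p])
  qed
qed

lemma endomorphism_p_minus:
  assumes P: "endomorphism P"
  shows "endomorphism (p_minus P)"
proof -
  \<comment> \<open>Subtraction is rewritten through addition and scaling, the operations for which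
    \<open>coords\<close> and \<open>tangent_space\<close> have rules.\<close>
  have eq: "p_minus P p v = (\<lambda>f. (1/2) * (v f + (- 1) * P p v f))" for p v
    by (simp add: p_minus_def)
  have matrix: "msmooth_on \<A> (U \<inter> V) (\<lambda>p. coords \<psi> (p_minus P p (coord_vec U \<phi> p w)))"
    if "(U, \<phi>) \<in> \<A>" "(V, \<psi>) \<in> \<A>" for U \<phi> V \<psi> w
    unfolding eq coords_scale coords_add
    using that
    by (intro msmooth_on_scaleR msmooth_on_add msmooth_on_const endomorphism_matrix[OF P]
        msmooth_on_coords_coord_vec) (auto intro: chart_open)
  have tangent: "p_minus P p v \<in> tangent_space \<A> p" if "v \<in> tangent_space \<A> p" for p v
    unfolding eq by (intro tangent_space_scale tangent_space_add endomorphism_tangent[OF P] that)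
  have add: "p_minus P p (\<lambda>f. v f + w f) = (\<lambda>f. p_minus P p v f + p_minus P p w f)"
    if "v \<in> tangent_space \<A> p" "w \<in> tangent_space \<A> p" for p v w
    by (simp add: fun_eq_iff p_minus_def endomorphism_add[OF P that] add_divide_distrib diff_divide_distrib)
  have scale: "p_minus P p (\<lambda>f. c * v f) = (\<lambda>f. c * p_minus P p v f)"
    if "v \<in> tangent_space \<A> p" for p v c
    by (simp add: p_minus_def endomorphism_scale[OF P that] right_diff_distrib)
  show ?thesis
    unfolding endomorphism_iff
  proof (intro conjI)
    show "\<forall>(U, \<phi>)\<in>\<A>. \<forall>(V, \<psi>)\<in>\<A>. \<forall>w.
        msmooth_on \<A> (U \<inter> V) (\<lambda>p. coords \<psi> (p_minus P p (coord_vec U \<phi> p w)))"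
      using matrix by fast
  qed (simp_all add: tangent add scale)
qed

end

section \<open>Contracted brackets in a Lie algebra\<close>

text \<open>Vector fields have a type built from two layers of functions into the reals. The
  pointwise structure makes that type a \<open>real_vector\<close>, so the fields form a subspace
  and abstract linear algebra applies to them.\<close>

instantiation "fun" :: (type, real_vector) real_vector
begin

definition scaleR_fun :: "real \<Rightarrow> ('a \<Rightarrow> 'b) \<Rightarrow> 'a \<Rightarrow> 'b" where
  "scaleR_fun c f = (\<lambda>x. c *\<^sub>R f x)"

instance
  by standard (simp_all add: scaleR_fun_def fun_eq_iff scaleR_add_right scaleR_add_left)

end

text \<open>The laws are relative to a carrier because \<open>Lie_bracket\<close> behaves well only
  on smooth fields. Linearity on the left and vanishing on the diagonal follow from
  antisymmetry.\<close>

locale lie_algebra_on =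
  fixes V :: "'v::real_vector set" and br :: "'v \<Rightarrow> 'v \<Rightarrow> 'v"
  assumes subspace_V: "subspace V"
    and br_closed: "X \<in> V \<Longrightarrow> Y \<in> V \<Longrightarrow> br X Y \<in> V"
    and br_add_right: "X \<in> V \<Longrightarrow> Y \<in> V \<Longrightarrow> Z \<in> V \<Longrightarrow> br X (Y + Z) = br X Y + br X Z"
    and br_scale_right: "X \<in> V \<Longrightarrow> Y \<in> V \<Longrightarrow> br X (c *\<^sub>R Y) = c *\<^sub>R br X Y"
    and br_swap: "X \<in> V \<Longrightarrow> Y \<in> V \<Longrightarrow> br Y X = - br X Y"
    and br_Jacobi: "X \<in> V \<Longrightarrow> Y \<in> V \<Longrightarrow> Z \<in> V \<Longrightarrow>
      br X (br Y Z) + br Y (br Z X) + br Z (br X Y) = 0"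
begin

lemmas V_add = subspace_add[OF subspace_V]
  and V_scale = subspace_scale[OF subspace_V]
  and V_diff = subspace_diff[OF subspace_V]

lemma br_diff_right:
  "X \<in> V \<Longrightarrow> Y \<in> V \<Longrightarrow> Z \<in> V \<Longrightarrow> br X (Y - Z) = br X Y - br X Z"
  using br_add_right[of X "Y - Z" Z] V_diff by (simp add: algebra_simps)

lemma br_add_left:
  "X \<in> V \<Longrightarrow> Y \<in> V \<Longrightarrow> Z \<in> V \<Longrightarrow> br (X + Y) Z = br X Z + br Y Z"
  using br_swap[of Z "X + Y"] br_swap[of Z X] br_swap[of Z Y] V_add by (simp add: br_add_right)

lemma br_diff_left:
  "X \<in> V \<Longrightarrow> Y \<in> V \<Longrightarrow> Z \<in> V \<Longrightarrow> br (X - Y) Z = br X Z - br Y Z"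
  using br_add_left[of "X - Y" Y Z] V_diff by (simp add: algebra_simps)

lemma br_scale_left: "X \<in> V \<Longrightarrow> Y \<in> V \<Longrightarrow> br (c *\<^sub>R X) Y = c *\<^sub>R br X Y"
  using br_swap[of Y "c *\<^sub>R X"] br_swap[of Y X] V_scale by (simp add: br_scale_right)

lemma br_self: "X \<in> V \<Longrightarrow> br X X = 0"
  using br_swap[of X X] scaleR_2[of "br X X"] by (simp add: eq_neg_iff_add_eq_0)

end

text \<open>\<open>N\<close> is only a linear map of the underlying vector space; no compatibility
  with the bracket is assumed.\<close>

locale lie_algebra_endomorphism = lie_algebra_on +
  fixes N :: "'v::real_vector \<Rightarrow> 'v"
  assumes N_closed: "X \<in> V \<Longrightarrow> N X \<in> V"
    and N_add: "X \<in> V \<Longrightarrow> Y \<in> V \<Longrightarrow> N (X + Y) = N X + N Y"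
    and N_scale: "X \<in> V \<Longrightarrow> N (c *\<^sub>R X) = c *\<^sub>R N X"
begin

text \<open>The abstract form of \<open>contracted_bracket\<close>: the first-order change of the
  bracket when it is transported along the flow exp(tN).\<close>

definition cbr :: "'v \<Rightarrow> 'v \<Rightarrow> 'v" where
  "cbr X Y = br (N X) Y + br X (N Y) - N (br X Y)"

lemma N_diff: "X \<in> V \<Longrightarrow> Y \<in> V \<Longrightarrow> N (X - Y) = N X - N Y"
  using N_add[of "X - Y" Y] V_diff by (simp add: algebra_simps)

lemma N_zero: "N 0 = 0"
  using N_scale[of 0 0] subspace_0[OF subspace_V] by simp

lemmas V_closed = br_closed N_closed V_add V_diff V_scale

lemma cbr_closed: "X \<in> V \<Longrightarrow> Y \<in> V \<Longrightarrow> cbr X Y \<in> V"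
  by (simp add: cbr_def V_closed)

lemma cbr_add:
  assumes "X \<in> V" "Y \<in> V" "Z \<in> V"
  shows "cbr (X + Y) Z = cbr X Z + cbr Y Z" "cbr X (Y + Z) = cbr X Y + cbr X Z"
  using assms by (simp_all add: cbr_def V_closed N_add br_add_left br_add_right)

lemma cbr_scale:
  assumes "X \<in> V" "Y \<in> V"
  shows "cbr (c *\<^sub>R X) Y = c *\<^sub>R cbr X Y" "cbr X (c *\<^sub>R Y) = c *\<^sub>R cbr X Y"
  using assms
  by (simp_all add: cbr_def V_closed N_scale br_scale_left br_scale_right scaleR_add_right
      scaleR_diff_right)

lemma cbr_self: "X \<in> V \<Longrightarrow> cbr X X = 0"
  using br_swap[of X "N X"] N_closed by (simp add: cbr_def br_self N_zero)

lemma cbr_Jacobi: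
  assumes torsion_free: "\<And>X Y. X \<in> V \<Longrightarrow> Y \<in> V \<Longrightarrow> br (N X) (N Y) = N (cbr X Y)"
    and XYZ: "X \<in> V" "Y \<in> V" "Z \<in> V"
  shows "cbr X (cbr Y Z) + cbr Y (cbr Z X) + cbr Z (cbr X Y) = 0"
proof -
  have expand: "cbr A (cbr B C) =
      br (N A) (br (N B) C) + br (N A) (br B (N C)) + br A (br (N B) (N C))
      - N (br (N A) (br B C)) - N (br A (br (N B) C)) - N (br A (br B (N C)))
      + N (N (br A (br B C)))"
    if "A \<in> V" "B \<in> V" "C \<in> V" for A B C
  proof -
    \<comment> \<open>Vanishing torsion for the pair \<open>A\<close>, \<open>br B C\<close>
      produces the term \<open>N (br A (N (br B C)))\<close>, which cancels against the same term of
      the outer contracted bracket. What survives are double brackets with two copies of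
      \<open>N\<close>, placed on arguments or outside the whole.\<close>
    have "br (N A) (N (br B C)) = N (br (N A) (br B C)) + N (br A (N (br B C))) - N (N (br A (br B C)))"
      using torsion_free[of A "br B C"] that by (simp add: cbr_def V_closed N_add N_diff)
    moreover have "N (cbr B C) = br (N B) (N C)"
      using torsion_free that by simp
    ultimately show ?thesis
      using that unfolding cbr_def[of A]
      by (simp add: cbr_def[of B C] V_closed N_add N_diff br_add_right br_diff_right algebra_simps)
  qed
  have N_Jacobi: "N (br A (br B C)) + N (br B (br C A)) + N (br C (br A B)) = 0"
    if "A \<in> V" "B \<in> V" "C \<in> V" for A B C
    using br_Jacobi[OF that] N_zero that by (simp add: V_closed flip: N_add)
  have NN_Jacobi: "N (N (br X (br Y Z))) + N (N (br Y (br Z X))) + N (N (br Z (br X Y))) = 0"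
    using N_Jacobi[OF XYZ] N_zero XYZ by (simp add: V_closed flip: N_add)
  note NV = XYZ[THEN N_closed]
  \<comment> \<open>The 21 terms are sorted by where the two copies of \<open>N\<close> sit: three
    groups with both on arguments, three with one on an argument and one outside, and one with both
    outside. Each group is a Jacobi sum or its image under \<open>N\<close> or \<open>N\<close>
    twice.\<close>
  have "cbr X (cbr Y Z) + cbr Y (cbr Z X) + cbr Z (cbr X Y) =
      (br (N X) (br (N Y) Z) + br (N Y) (br Z (N X)) + br Z (br (N X) (N Y)))
    + (br (N X) (br Y (N Z)) + br Y (br (N Z) (N X)) + br (N Z) (br (N X) Y))
    + (br X (br (N Y) (N Z)) + br (N Y) (br (N Z) X) + br (N Z) (br X (N Y)))
    - (N (br (N X) (br Y Z)) + N (br Y (br Z (N X))) + N (br Z (br (N X) Y)))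
    - (N (br X (br (N Y) Z)) + N (br (N Y) (br Z X)) + N (br Z (br X (N Y))))
    - (N (br X (br Y (N Z))) + N (br Y (br (N Z) X)) + N (br (N Z) (br X Y)))
    + (N (N (br X (br Y Z))) + N (N (br Y (br Z X))) + N (N (br Z (br X Y))))"
    unfolding expand[OF XYZ] expand[OF XYZ(2,3,1)] expand[OF XYZ(3,1,2)]
    by (simp only: diff_conv_add_uminus minus_add_distrib ac_simps)
  also have "\<dots> = 0"
    by (simp only: br_Jacobi[OF NV(1,2) XYZ(3)] br_Jacobi[OF NV(1) XYZ(2) NV(3)]
        br_Jacobi[OF XYZ(1) NV(2,3)] N_Jacobi[OF NV(1) XYZ(2,3)] N_Jacobi[OF XYZ(1) NV(2) XYZ(3)]
        N_Jacobi[OF XYZ(1,2) NV(3)] NN_Jacobi) simp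
  finally show ?thesis .
qed

text \<open>Here \<open>N\<close> plays the role of the product structure and \<open>Q\<close> that
  of \<open>p_minus\<close>. The identity is first proved for twice \<open>Q\<close>, the identity
  minus \<open>N\<close>, where no fractions occur.\<close>

lemma half_complement_torsion_free:
  assumes involution: "\<And>X. X \<in> V \<Longrightarrow> N (N X) = X"
    and torsion_free: "\<And>X Y. X \<in> V \<Longrightarrow> Y \<in> V \<Longrightarrow>
      br (N X) (N Y) - N (br (N X) Y) - N (br X (N Y)) + N (N (br X Y)) = 0"
    and Q: "\<And>X. X \<in> V \<Longrightarrow> Q X = (1/2) *\<^sub>R (X - N X)"
    and XY: "X \<in> V" "Y \<in> V"
  shows "br (Q X) (Q Y) = Q (br (Q X) Y + br X (Q Y) - Q (br X Y))"
proof -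
  have "br (N X) (N Y) = N (br (N X) Y) + N (br X (N Y)) - br X Y"
    using torsion_free[OF XY] involution[of "br X Y"] XY by (simp add: V_closed algebra_simps)
  moreover have "N (N (br X Y)) = br X Y"
    using XY by (simp add: involution V_closed)
  \<comment> \<open>The contracted bracket of \<open>X\<close> and \<open>Y\<close> for the identity
    minus \<open>N\<close>.\<close>
  moreover define E where "E = br (X - N X) Y + br X (Y - N Y) - (br X Y - N (br X Y))"
  ultimately have *: "br (X - N X) (Y - N Y) = E - N E"
    using XY by (simp add: V_closed N_add N_diff br_diff_left br_diff_right)
  have E: "E \<in> V" using XY by (simp add: E_def V_closed)
  \<comment> \<open>On the left both factors 1/2 come from bilinearity; on the right one comes from
    the outer \<open>Q\<close> and the other from the contracted bracket, which is linear in the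
    endomorphism.\<close>
  have "br (Q X) (Q Y) = (1/4) *\<^sub>R br (X - N X) (Y - N Y)"
    using XY unfolding Q[OF XY(1)] Q[OF XY(2)]
    by (simp add: br_scale_left br_scale_right V_closed del: scaleR_right_diff_distrib)
  also have "\<dots> = Q ((1/2) *\<^sub>R E)"
    using E by (simp add: * Q V_closed N_scale scaleR_diff_right)
  also have "(1/2) *\<^sub>R E = br (Q X) Y + br X (Q Y) - Q (br X Y)"
    using XY unfolding Q[OF XY(1)] Q[OF XY(2)] Q[OF br_closed[OF XY]] E_def
    by (simp add: br_scale_left br_scale_right V_closed scaleR_diff_right[of _ "_ + _"] scaleR_add_right
        del: scaleR_right_diff_distrib)
  finally show ?thesis .
qed

end

section \<open>The Lie algebroid of a product structure\<close>

context smooth_manifold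
begin

text \<open>With its two companions this translates the section operations of the tangent bundle
  into the arithmetic of the function type used by the abstract Lie algebra.\<close>

lemma sec_add_TM: "sec_add TM X Y = X + Y"
  by (simp add: sec_add_def tangent_bundle_simps fun_eq_iff)

lemma sec_zero_TM: "sec_zero TM = 0"
  by (simp add: sec_zero_def tangent_bundle_simps fun_eq_iff)

lemma sec_mult_const_TM: "sec_mult TM (\<lambda>_. c) X = c *\<^sub>R X"
  by (simp add: sec_mult_def tangent_bundle_simps fun_eq_iff scaleR_fun_def)

lemma lie_algebra_vector_fields: "lie_algebra_on (vector_fields \<A>) (Lie_bracket \<A>)"
proof
  show "subspace (vector_fields \<A>)"
  proof (rule subspaceI)
    show "0 \<in> vector_fields \<A>"
      using vector_fields_zero by (simp add: zero_fun_def)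
    show "X + Y \<in> vector_fields \<A>" if "X \<in> vector_fields \<A>" "Y \<in> vector_fields \<A>" for X Y
      using vector_fields_add[OF that] by (simp add: plus_fun_def)
    show "c *\<^sub>R X \<in> vector_fields \<A>" if "X \<in> vector_fields \<A>" for c X
      using vector_fields_mult[OF that smooth_functions_const] by (simp add: sec_mult_const_TM)
  qed
next
  fix X Y Z c
  assume X: "X \<in> vector_fields \<A>" and Y: "Y \<in> vector_fields \<A>"
  show "Lie_bracket \<A> X Y \<in> vector_fields \<A>"
    by (rule vector_fields_Lie_bracket[OF X Y])
  show "Lie_bracket \<A> Y X = - Lie_bracket \<A> X Y"
    by (simp add: Lie_bracket_swap[of Y X] fun_eq_iff)
  show "Lie_bracket \<A> X (c *\<^sub>R Y) = c *\<^sub>R Lie_bracket \<A> X Y"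
    \<comment> \<open>A real factor is a constant function; its derivative along \<open>X\<close> is
      0, so the Leibniz rule reduces to homogeneity.\<close>
    using Lie_bracket_mult_right[OF X Y smooth_functions_const[of c]]
      tangent_const[OF vector_field_tangent[OF X]]
    by (simp add: sec_mult_const_TM apply_field_def) (simp add: scaleR_fun_def)
  assume Z: "Z \<in> vector_fields \<A>"
  show "Lie_bracket \<A> X (Y + Z) = Lie_bracket \<A> X Y + Lie_bracket \<A> X Z"
    using Lie_bracket_add_right[OF X Y Z] by (simp add: plus_fun_def)
  show "Lie_bracket \<A> X (Lie_bracket \<A> Y Z) + Lie_bracket \<A> Y (Lie_bracket \<A> Z X)
      + Lie_bracket \<A> Z (Lie_bracket \<A> X Y) = 0"
    using Lie_bracket_Jacobi[OF X Y Z] by (simp add: fun_eq_iff)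
qed

lemma on_sections_mult:
  assumes "endomorphism N" "X \<in> vector_fields \<A>"
  shows "on_sections N (sec_mult TM h X) = sec_mult TM h (on_sections N X)"
  by (simp add: on_sections_def sec_mult_def tangent_bundle_simps endomorphism_scale[OF assms(1)]
      vector_field_tangent[OF assms(2)])

lemma on_sections_add:
  assumes "endomorphism N" "X \<in> vector_fields \<A>" "Y \<in> vector_fields \<A>"
  shows "on_sections N (X + Y) = on_sections N X + on_sections N Y"
  using endomorphism_add[OF assms(1) vector_field_tangent[OF assms(2)] vector_field_tangent[OF assms(3)]]
  by (simp add: on_sections_def plus_fun_def)

lemma lie_algebra_endomorphism_on_sections:
  assumes "endomorphism N"
  shows "lie_algebra_endomorphism (vector_fields \<A>) (Lie_bracket \<A>) (on_sections N)"
  using assms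
  by (intro lie_algebra_endomorphism.intro lie_algebra_vector_fields
      lie_algebra_endomorphism_axioms.intro)
    (simp_all add: on_sections_vector_fields on_sections_add on_sections_mult
      flip: sec_mult_const_TM)

lemma contracted_bracket_eq:
  "contracted_bracket \<A> N X Y = Lie_bracket \<A> (on_sections N X) Y + Lie_bracket \<A> X (on_sections N Y)
    - on_sections N (Lie_bracket \<A> X Y)"
  by (simp add: contracted_bracket_def fun_eq_iff)

text \<open>The derivative of \<open>h\<close> along \<open>X\<close> appears with the coefficient
  \<open>on_sections N Y\<close> twice, once from the bracket of \<open>X\<close> with
  \<open>N\<close> of the product and once, with opposite sign, from \<open>N\<close> of the
  bracket. Only the derivative along \<open>on_sections N X\<close> remains, which makes
  \<open>N\<close> the anchor.\<close>

lemma contracted_bracket_Leibniz: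
  assumes N: "endomorphism N" and X: "X \<in> vector_fields \<A>" and Y: "Y \<in> vector_fields \<A>"
    and h: "h \<in> smooth_functions \<A>"
  shows "contracted_bracket \<A> N X (sec_mult TM h Y) =
    sec_mult TM h (contracted_bracket \<A> N X Y) + sec_mult TM (apply_field (on_sections N X) h) Y"
proof -
  note NX = on_sections_vector_fields[OF N X] and NY = on_sections_vector_fields[OF N Y]
  have rule: "Lie_bracket \<A> A (sec_mult TM h B) =
      sec_mult TM h (Lie_bracket \<A> A B) + sec_mult TM (apply_field A h) B"
    if "A \<in> vector_fields \<A>" "B \<in> vector_fields \<A>" for A B
    using Lie_bracket_mult_right[OF that h]
    by (simp add: sec_mult_def tangent_bundle_simps fun_eq_iff)
  have "on_sections N (Lie_bracket \<A> X (sec_mult TM h Y)) =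
      sec_mult TM h (on_sections N (Lie_bracket \<A> X Y)) + sec_mult TM (apply_field X h) (on_sections N Y)"
    by (simp add: rule X Y on_sections_add[OF N] on_sections_mult[OF N] vector_fields_Lie_bracket
        vector_fields_mult h smooth_functions_apply_field)
  then show ?thesis
    by (simp add: contracted_bracket_eq on_sections_mult[OF N Y] rule X Y NX NY)
      (simp add: sec_mult_def tangent_bundle_simps fun_eq_iff algebra_simps)
qed

lemma lie_algebroid_p_minus:
  assumes "product_structure \<A> P"
  shows "lie_algebroid \<A> TM (p_minus P) (contracted_bracket \<A> (p_minus P))"
proof -
  let ?N = "p_minus P" and ?V = "vector_fields \<A>"
  have P: "endomorphism P" and PP: "\<And>p v. v \<in> tangent_space \<A> p \<Longrightarrow> P p (P p v) = v"
    and torsion: "\<And>X Y. X \<in> ?V \<Longrightarrow> Y \<in> ?V \<Longrightarrow> Nijenhuis_torsion \<A> P X Y = 0"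
    using assms by (auto simp: product_structure_def almost_product_structure_def endomorphism_def
        sec_zero_TM)
  have N: "endomorphism ?N" by (rule endomorphism_p_minus[OF P])
  \<comment> \<open>Two instances over the same Lie algebra: the one for \<open>P\<close> transfers
    the vanishing torsion to \<open>p_minus P\<close>, the one for \<open>p_minus P\<close> then
    yields the Lie bracket laws.\<close>
  interpret P: lie_algebra_endomorphism ?V "Lie_bracket \<A>" "on_sections P"
    by (rule lie_algebra_endomorphism_on_sections[OF P])
  interpret N: lie_algebra_endomorphism ?V "Lie_bracket \<A>" "on_sections ?N"
    by (rule lie_algebra_endomorphism_on_sections[OF N])
  have cbr: "contracted_bracket \<A> ?N = N.cbr"
    by (simp add: contracted_bracket_eq N.cbr_def fun_eq_iff)
  have torsion_free: "Lie_bracket \<A> (on_sections ?N X) (on_sections ?N Y) = on_sections ?N (N.cbr X Y)"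
    if "X \<in> ?V" "Y \<in> ?V" for X Y
    unfolding N.cbr_def
  proof (rule P.half_complement_torsion_free[OF _ _ _ that])
    show "on_sections P (on_sections P X) = X" if "X \<in> ?V" for X
      by (simp add: on_sections_def PP vector_field_tangent[OF that])
    show "Lie_bracket \<A> (on_sections P X) (on_sections P Y)
        - on_sections P (Lie_bracket \<A> (on_sections P X) Y)
        - on_sections P (Lie_bracket \<A> X (on_sections P Y))
        + on_sections P (on_sections P (Lie_bracket \<A> X Y)) = 0" if "X \<in> ?V" "Y \<in> ?V" for X Y
      using torsion[OF that] by (simp add: Nijenhuis_torsion_def fun_eq_iff)
    show "on_sections ?N X = (1/2) *\<^sub>R (X - on_sections P X)" for X
      by (simp add: on_sections_def p_minus_def scaleR_fun_def fun_eq_iff)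
  qed
  have "lie_bracket_on_sections \<A> TM (contracted_bracket \<A> ?N)"
    unfolding lie_bracket_on_sections_def cbr sec_add_TM sec_zero_TM sec_mult_const_TM
      vector_fields_def[symmetric]
    using N.cbr_Jacobi[OF torsion_free]
    by (simp add: N.cbr_closed N.cbr_add N.cbr_scale N.cbr_self add.assoc)
  then show ?thesis
    unfolding lie_algebroid_def vector_fields_def[symmetric] sec_add_TM
    using vector_bundle_TM N contracted_bracket_Leibniz[OF N]
    by (simp add: endomorphism_def)
qed

text \<open>The contracted bracket is linear in the endomorphism, and for the identity it is the
  ordinary bracket.\<close>

lemma contracted_bracket_p_minus:
  assumes P: "endomorphism P" and X: "X \<in> vector_fields \<A>" and Y: "Y \<in> vector_fields \<A>"
  shows "contracted_bracket \<A> (p_minus P) X Y =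
    (\<lambda>p f. 1/2 * (Lie_bracket \<A> X Y p f - contracted_bracket \<A> P X Y p f))"
proof -
  interpret P: lie_algebra_endomorphism "vector_fields \<A>" "Lie_bracket \<A>" "on_sections P"
    by (rule lie_algebra_endomorphism_on_sections[OF P])
  have half: "on_sections (p_minus P) Z = (1/2) *\<^sub>R (Z - on_sections P Z)" for Z
    by (simp add: on_sections_def p_minus_def scaleR_fun_def fun_eq_iff)
  have "contracted_bracket \<A> (p_minus P) X Y =
      (1/2) *\<^sub>R ((Lie_bracket \<A> X Y - Lie_bracket \<A> (on_sections P X) Y)
      + (Lie_bracket \<A> X Y - Lie_bracket \<A> X (on_sections P Y))
      - (Lie_bracket \<A> X Y - on_sections P (Lie_bracket \<A> X Y)))"
    using X Y
    by (simp add: contracted_bracket_eq half P.V_closed P.br_scale_left P.br_scale_right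
        P.br_diff_left P.br_diff_right scaleR_add_right scaleR_diff_right)
  then show ?thesis
    by (simp add: contracted_bracket_def scaleR_fun_def fun_eq_iff)
qed

end

theorem theorem8p1:
  fixes \<A> :: "('a::{t2_space,second_countable_topology}, 'b::euclidean_space) atlas"
    and P :: "'a \<Rightarrow> 'a tvec \<Rightarrow> 'a tvec"
  assumes "smooth_atlas \<A>"
    and "product_structure \<A> P"
  shows "\<exists>q br. lie_algebroid \<A> (tangent_bundle \<A>) q br \<and>
     q = p_minus P \<and>
     (\<forall>X\<in>vector_fields \<A>. \<forall>Y\<in>vector_fields \<A>.
        br X Y = contracted_bracket \<A> (p_minus P) X Y \<and>
        br X Y = (\<lambda>p f. 1/2 * (Lie_bracket \<A> X Y p f - contracted_bracket \<A> P X Y p f)))"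
proof -
  interpret smooth_manifold \<A> by standard (rule assms(1))
  have "endomorphism P"
    using assms(2) by (simp add: product_structure_def almost_product_structure_def endomorphism_def)
  then show ?thesis
    using lie_algebroid_p_minus[OF assms(2)] contracted_bracket_p_minus by blast
qed

end
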